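(* Let $\alpha$ be a non-zero algebraic number and suppose $\bar\alpha_1,\ldots,\bar\alpha_N\in V$ satisfy $\pi(\alpha)=\bar\alpha_1\cdots\bar\alpha_N$. Then there exist $\bar\beta_1,\ldots,\bar\beta_N\in V$ with $\pi(\alpha)=\bar\beta_1\cdots\bar\beta_N$ such that $\bar\beta_n\in S(K_\alpha)$ and $\bar M(\bar\beta_n)\le\bar M(\bar\alpha_n)$ for all $n$.
   Context: For a non-zero algebraic number $\gamma$ with minimal polynomial $A\prod_{n=1}^N(x-\gamma_n)$ over $\mathbb Z$ (primitive, $A>0$), $M(\gamma)=A\prod_{n=1}^N\max\{1,|\gamma_n|\}$. $V=\overline{\mathbb Q}^\times/\mathrm{Tor}(\overline{\mathbb Q}^\times)$ (written multiplicatively) with quotient map $\pi$. For $\bar\beta\in V$, $\bar M(\bar\beta)=\inf\{M(\beta):\beta\in\pi^{-1}(\bar\beta)\}$. $K_\alpha$ is the Galois closure of $\mathbb Q(\alpha)$ over $\mathbb Q$. For a number field $K$, $\mathrm{rad}(K)=\{\gamma\in\overline{\mathbb Q}^\times:\gamma^n\in K\text{ for some }n\in\mathbb N\}$ and $S(K)=\pi(\mathrm{rad}(K))$. *)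

theory Defs
  imports Complex_Main "HOL-Computational_Algebra.Polynomial" "HOL-Computational_Algebra.Polynomial_Factorial"
begin

text \<open>We work inside the complex numbers; the algebraic closure of Q is the set of
  complex numbers satisfying the library predicate algebraic.\<close>

definition root_of_unity :: "complex \<Rightarrow> bool" where
  "root_of_unity z \<longleftrightarrow> (\<exists>n::nat. n > 0 \<and> z ^ n = 1)"

definition min_int_poly :: "complex \<Rightarrow> int poly" where
  "min_int_poly \<gamma> = (THE p. irreducible p \<and> content p = 1 \<and> lead_coeff p > 0 \<and>
       poly (map_poly of_int p) \<gamma> = 0)"

definition mahler :: "complex \<Rightarrow> real" where
  "mahler \<gamma> = (let p = min_int_poly \<gamma>; q = (map_poly of_int p :: complex poly) in
     of_int (lead_coeff p) * (\<Prod>z\<in>{z. poly q z = 0}. max 1 (cmod z) ^ order z q))"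

text \<open>V = nonzero algebraic numbers modulo torsion; elements of V are represented
  by nonzero algebraic complex numbers, pi a = pi b iff a / b is a root of unity.\<close>
definition alg_nz :: "complex \<Rightarrow> bool" where
  "alg_nz z \<longleftrightarrow> algebraic z \<and> z \<noteq> 0"

definition same_class :: "complex \<Rightarrow> complex \<Rightarrow> bool" where
  "same_class a b \<longleftrightarrow> root_of_unity (a / b)"

definition mahler_bar :: "complex \<Rightarrow> real" where
  "mahler_bar b = Inf {mahler \<beta> | \<beta>. alg_nz \<beta> \<and> same_class \<beta> b}"

definition is_subfield :: "complex set \<Rightarrow> bool" where
  "is_subfield F \<longleftrightarrow> 0 \<in> F \<and> 1 \<in> F \<and> (\<forall>x\<in>F. \<forall>y\<in>F. x + y \<in> F \<and> x - y \<in> F \<and> x * y \<in> F)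
     \<and> (\<forall>x\<in>F. inverse x \<in> F)"

definition gen_field :: "complex set \<Rightarrow> complex set" where
  "gen_field S = \<Inter>{F. is_subfield F \<and> S \<subseteq> F}"

definition galois_closure :: "complex \<Rightarrow> complex set" where
  "galois_closure \<alpha> = gen_field {z. poly (map_poly of_int (min_int_poly \<alpha>)) z = 0}"

definition rad :: "complex set \<Rightarrow> complex set" where
  "rad K = {\<gamma>. alg_nz \<gamma> \<and> (\<exists>n::nat. n > 0 \<and> \<gamma> ^ n \<in> K)}"

definition in_S :: "complex set \<Rightarrow> complex \<Rightarrow> bool" where
  "in_S K b \<longleftrightarrow> (\<exists>c\<in>rad K. same_class b c)"

end

theory Submission
  imports Defs "Jordan_Normal_Form.Char_Poly"
begin

text \<open>
  Let \<open>K\<close> be the Galois closure of \<open>\<rat>(\<alpha>)\<close>. Replace each \<open>\<alpha>\<^sub>n\<close> by \<open>\<beta>\<^sub>n\<close>, a \<open>d\<close>-th root of the product of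
  the \<open>d\<close> conjugates of \<open>\<alpha>\<^sub>n\<close> over \<open>K\<close>. This product is fixed by the automorphisms over \<open>K\<close>, so it lies in
  \<open>K\<close>; modulo torsion \<open>\<beta>\<^sub>n\<close> is the average of \<open>\<alpha>\<^sub>n\<close> over these automorphisms, which is multiplicative,
  independent of the representative of \<open>\<alpha>\<^sub>n\<close>, and fixes \<open>\<alpha>\<close>.

  To compare Mahler measures, let \<open>A\<close> be the leading coefficient of the minimal polynomial of \<open>\<alpha>\<^sub>n\<close>.
  Because \<open>K\<close> is normal, the absolute Galois group permutes the sets \<open>X\<close> of \<open>K\<close>-conjugates among the
  conjugates of \<open>\<alpha>\<^sub>n\<close>, all of size \<open>d\<close>. So \<open>P = A \<Prod>\<^sub>X (x\<^sup>d - \<Prod>X)\<close> is rational, and since \<open>A\<close> times a product of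
  distinct roots is an algebraic integer, \<open>P\<close> is integral. It vanishes at \<open>\<beta>\<^sub>n\<close>, and its Mahler measure
  \<open>A \<Prod>\<^sub>X max(1, |\<Prod>X|)\<close> is at most that of \<open>\<alpha>\<^sub>n\<close>.
\<close>

section \<open>Algebraic integers\<close>

definition Zspan :: "complex set \<Rightarrow> complex set" where
  "Zspan V = range (\<lambda>c :: complex \<Rightarrow> int. \<Sum>v\<in>V. of_int (c v) * v)"

lemma Zspan_0: "0 \<in> Zspan V"
  unfolding Zspan_def by (rule range_eqI[of _ _ "\<lambda>_. 0"]) simp

lemma Zspan_add:
  assumes "x \<in> Zspan V" "y \<in> Zspan V"
  shows "x + y \<in> Zspan V"
proof -
  obtain c d where "x = (\<Sum>v\<in>V. of_int (c v) * v)" "y = (\<Sum>v\<in>V. of_int (d v) * v)"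
    using assms unfolding Zspan_def by blast
  then show ?thesis
    unfolding Zspan_def
    by (intro range_eqI[of _ _ "\<lambda>v. c v + d v"]) (simp add: ring_distribs sum.distrib)
qed

lemma Zspan_of_int_mult:
  assumes "x \<in> Zspan V"
  shows "of_int k * x \<in> Zspan V"
proof -
  obtain c where "x = (\<Sum>v\<in>V. of_int (c v) * v)"
    using assms unfolding Zspan_def by blast
  then show ?thesis
    unfolding Zspan_def
    by (intro range_eqI[of _ _ "\<lambda>v. k * c v"]) (simp add: sum_distrib_left mult.assoc)
qed

lemma Zspan_sum: "(\<And>i. i \<in> I \<Longrightarrow> f i \<in> Zspan V) \<Longrightarrow> sum f I \<in> Zspan V"
  by (induction I rule: infinite_finite_induct) (auto intro: Zspan_0 Zspan_add)

lemma Zspan_base: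
  assumes "finite V" "v \<in> V"
  shows "v \<in> Zspan V"
proof -
  have "(\<Sum>u\<in>V. of_int (if u = v then 1 else 0) * u) = (\<Sum>u\<in>V. if u = v then u else 0)"
    by (rule sum.cong) auto
  then show ?thesis
    unfolding Zspan_def using assms
    by (intro range_eqI[of _ _ "\<lambda>u. if u = v then 1 else 0"]) simp
qed

text \<open>The multiplier ring of the group generated by \<open>V\<close>, tested on generators.
  Membership for some finite \<open>V\<close> containing 1 is the working form of integrality: it is
  closed under sums and products without any manipulation of polynomials.\<close>

definition Zstab :: "complex set \<Rightarrow> complex set" where
  "Zstab V = {x. \<forall>v\<in>V. x * v \<in> Zspan V}"

lemma Zstab_mult_Zspan:
  assumes "x \<in> Zstab V" "y \<in> Zspan V"
  shows "x * y \<in> Zspan V"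
proof -
  obtain c where c: "y = (\<Sum>v\<in>V. of_int (c v) * v)"
    using assms unfolding Zspan_def by blast
  have "x * y = (\<Sum>v\<in>V. of_int (c v) * (x * v))"
    by (simp add: c sum_distrib_left mult_ac)
  also have "\<dots> \<in> Zspan V"
    using assms(1) by (intro Zspan_sum Zspan_of_int_mult) (auto simp: Zstab_def)
  finally show ?thesis .
qed

lemma Zstab_of_int: "finite V \<Longrightarrow> of_int k \<in> Zstab V"
  by (auto simp: Zstab_def intro: Zspan_of_int_mult Zspan_base)

lemma Zstab_add: "x \<in> Zstab V \<Longrightarrow> y \<in> Zstab V \<Longrightarrow> x + y \<in> Zstab V"
  by (auto simp: Zstab_def ring_distribs intro: Zspan_add)

lemma Zstab_mult: "x \<in> Zstab V \<Longrightarrow> y \<in> Zstab V \<Longrightarrow> x * y \<in> Zstab V"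
  by (auto simp: Zstab_def mult.assoc intro: Zstab_mult_Zspan[unfolded Zstab_def])

text \<open>Multiplication by \<open>x\<close> is an integer matrix \<open>A\<close> in the generators \<open>V\<close>, so \<open>x\<close> is a root of the
  characteristic polynomial of \<open>A\<close>.\<close>
lemma algebraic_int_if_Zstab:
  assumes V: "finite V" "1 \<in> V" and x: "x \<in> Zstab V"
  shows "algebraic_int x"
proof -
  obtain vs where vs: "set vs = V" "distinct vs"
    using finite_distinct_list[OF V(1)] by blast
  define n where "n = length vs"
  have "\<forall>v\<in>V. \<exists>c :: complex \<Rightarrow> int. x * v = (\<Sum>u\<in>V. of_int (c u) * u)"
    using x unfolding Zstab_def Zspan_def by blast
  then obtain C :: "complex \<Rightarrow> complex \<Rightarrow> int"
    where C: "\<And>v. v \<in> V \<Longrightarrow> x * v = (\<Sum>u\<in>V. of_int (C v u) * u)"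
    by metis
  define A :: "int mat" where "A = mat n n (\<lambda>(i, j). C (vs ! i) (vs ! j))"
  define w :: "complex vec" where "w = vec n (\<lambda>i. vs ! i)"
  have A: "A \<in> carrier_mat n n" by (simp add: A_def)
  let ?B = "map_mat of_int A :: complex mat"
  have B: "?B \<in> carrier_mat n n" using A by simp
  have "?B *\<^sub>v w = x \<cdot>\<^sub>v w"
  proof (rule eq_vecI)
    fix i assume "i < dim_vec (x \<cdot>\<^sub>v w)"
    then have i: "i < n" by (simp add: w_def)
    have "(?B *\<^sub>v w) $ i = (\<Sum>j<n. of_int (C (vs ! i) (vs ! j)) * vs ! j)"
      using i by (simp add: A_def w_def scalar_prod_def atLeast0LessThan)
    also have "\<dots> = (\<Sum>u\<in>V. of_int (C (vs ! i) u) * u)"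
      by (rule sum.reindex_bij_betw) (use bij_betw_nth[OF vs(2)] vs(1) n_def in auto)
    also have "\<dots> = x * vs ! i"
      using i vs(1) by (intro C[symmetric]) (auto simp: n_def)
    finally show "(?B *\<^sub>v w) $ i = (x \<cdot>\<^sub>v w) $ i"
      using i by (simp add: w_def)
  qed (simp add: A_def w_def)
  \<comment> \<open>The entry 1 of \<open>V\<close> guarantees that the candidate eigenvector
    \<open>w\<close> is non-zero.\<close>
  moreover obtain i where "i < n" "vs ! i = 1"
    using V(2) vs(1) by (metis in_set_conv_nth n_def)
  then have "w \<noteq> 0\<^sub>v n"
    by (metis w_def index_vec index_zero_vec(1) one_neq_zero)
  ultimately have "eigenvalue ?B x"
    using B unfolding eigenvalue_def eigenvector_def by (auto simp: w_def A_def intro!: exI[of _ w])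
  then have "poly (char_poly ?B) x = 0"
    using eigenvalue_root_char_poly[OF B] by simp
  then have "poly (map_poly of_int (char_poly A)) x = 0"
    by (simp add: of_int_hom.char_poly_hom[OF A])
  then show ?thesis
    unfolding algebraic_int_altdef_ipoly using degree_monic_char_poly[OF A] by auto
qed

text \<open>The new generators are the products of elements of \<open>V\<close> with the powers of
  \<open>x\<close> below the degree n of \<open>p\<close>. The monic equation rewrites x^n by lower
  powers with coefficients that act on the group of \<open>V\<close>, so \<open>x\<close> is a
  multiplier; old multipliers act on the factor from \<open>V\<close> alone. Allowing coefficients
  in \<open>Zstab V\<close> also covers integral equations over algebraic integers.\<close>

lemma Zstab_adjoin_root:
  assumes V: "finite V" "1 \<in> V"
    and p: "lead_coeff p = 1" "\<And>i. coeff p i \<in> Zstab V" "poly p x = 0"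
  obtains W where "finite W" "1 \<in> W" "Zstab V \<subseteq> Zstab W" "x \<in> Zstab W"
proof -
  define n where "n = degree p"
  have n: "n > 0"
  proof (rule ccontr)
    assume "\<not> n > 0"
    then obtain c where "p = [:c:]" unfolding n_def by (auto elim: degree_eq_zeroE)
    then show False using p by simp
  qed
  define W where "W = (\<lambda>(v, j). v * x ^ j) ` (V \<times> {..<n})"
  have fin: "finite W" using V by (simp add: W_def)
  have one: "1 \<in> W"
    unfolding W_def using V n by (intro image_eqI[of _ _ "(1, 0)"]) auto
  have mem: "v * x ^ j \<in> Zspan W" if vj: "v \<in> Zspan V" "j < n" for v j
  proof -
    obtain c where c: "v = (\<Sum>u\<in>V. of_int (c u) * u)"
      using vj unfolding Zspan_def by blast
    have "v * x ^ j = (\<Sum>u\<in>V. of_int (c u) * (u * x ^ j))"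
      by (simp add: c sum_distrib_right mult.assoc)
    also have "\<dots> \<in> Zspan W"
      by (intro Zspan_sum Zspan_of_int_mult Zspan_base fin) (use vj in \<open>auto simp: W_def\<close>)
    finally show ?thesis .
  qed
  have sub: "Zstab V \<subseteq> Zstab W"
  proof
    fix y assume y: "y \<in> Zstab V"
    show "y \<in> Zstab W"
      unfolding Zstab_def
    proof (safe)
      fix w assume "w \<in> W"
      then obtain v j where w: "v \<in> V" "j < n" "w = v * x ^ j" by (auto simp: W_def)
      have "y * v \<in> Zspan V" using y w by (auto simp: Zstab_def)
      from mem[OF this w(2)] show "y * w \<in> Zspan W" by (simp add: w(3) mult.assoc)
    qed
  qed
  have "x \<in> Zstab W"
    unfolding Zstab_def
  proof safe
    fix w assume "w \<in> W"
    then obtain v j where w: "v \<in> V" "j < n" "w = v * x ^ j" by (auto simp: W_def)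
    show "x * w \<in> Zspan W"
    proof (cases "Suc j < n")
      case True
      then show ?thesis
        using mem[of v "Suc j"] w Zspan_base[OF V(1)] by (simp add: mult_ac)
    next
      case False
      then have j: "Suc j = n" using w by simp
      have "0 = (\<Sum>i<n. coeff p i * x ^ i) + x ^ n"
        using p unfolding poly_altdef n_def by (simp add: lessThan_Suc_atMost[symmetric])
      then have "x ^ n = (\<Sum>i<n. of_int (-1) * (coeff p i * x ^ i))"
        by (simp add: sum_negf eq_neg_iff_add_eq_0 add.commute)
      then have "v * x ^ n = (\<Sum>i<n. of_int (-1) * (coeff p i * v * x ^ i))"
        by (simp only: sum_distrib_left mult.left_commute mult.commute mult.assoc)
      moreover have "x * w = v * x ^ n"
        by (simp add: w(3) j[symmetric])
      ultimately have "x * w = (\<Sum>i<n. of_int (-1) * (coeff p i * v * x ^ i))"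
        by simp
      also have "\<dots> \<in> Zspan W"
        using p(2) w(1) by (intro Zspan_sum Zspan_of_int_mult mem) (auto simp: Zstab_def)
      finally show ?thesis .
    qed
  qed
  with fin one sub show ?thesis by (rule that)
qed

text \<open>Adjoining the elements one after another puts them all into one multiplier ring, in
  which they can be added and multiplied.\<close>

lemma Zstab_finite_algebraic_int:
  assumes "finite X" "\<And>x. x \<in> X \<Longrightarrow> algebraic_int x"
  obtains V where "finite V" "1 \<in> V" "X \<subseteq> Zstab V"
proof -
  have "\<exists>V. finite V \<and> 1 \<in> V \<and> X \<subseteq> Zstab V"
    using assms
  proof (induction X rule: finite_induct)
    case empty
    show ?case by (rule exI[of _ "{1}"]) simp
  next
    case (insert x X)
    then obtain V where V: "finite V" "1 \<in> V" "X \<subseteq> Zstab V" by auto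
    obtain p where p: "lead_coeff p = 1" "\<And>i. coeff p i \<in> \<int>" "poly p x = 0"
      using insert.prems[of x] by (auto elim: algebraic_int.cases)
    have "\<And>i. coeff p i \<in> Zstab V"
      using p(2) Zstab_of_int[OF V(1)] by (metis Ints_cases)
    with V p obtain W where "finite W" "1 \<in> W" "Zstab V \<subseteq> Zstab W" "x \<in> Zstab W"
      using Zstab_adjoin_root by metis
    with V show ?case by blast
  qed
  then show ?thesis using that by blast
qed

section \<open>Ring operations, integral closure and denominators\<close>

lemma algebraic_int_add:
  assumes "algebraic_int x" "algebraic_int (y :: complex)"
  shows "algebraic_int (x + y)"
proof -
  obtain V where "finite V" "1 \<in> V" "{x, y} \<subseteq> Zstab V"
    by (rule Zstab_finite_algebraic_int[of "{x, y}"]) (use assms in auto)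
  then show ?thesis by (intro algebraic_int_if_Zstab[of V] Zstab_add) auto
qed

lemma algebraic_int_mult:
  assumes "algebraic_int x" "algebraic_int (y :: complex)"
  shows "algebraic_int (x * y)"
proof -
  obtain V where "finite V" "1 \<in> V" "{x, y} \<subseteq> Zstab V"
    by (rule Zstab_finite_algebraic_int[of "{x, y}"]) (use assms in auto)
  then show ?thesis by (intro algebraic_int_if_Zstab[of V] Zstab_mult) auto
qed

lemma algebraic_int_diff:
  "algebraic_int x \<Longrightarrow> algebraic_int (y :: complex) \<Longrightarrow> algebraic_int (x - y)"
  using algebraic_int_add[of x "- y"] by simp

lemma algebraic_int_sum:
  "(\<And>i. i \<in> I \<Longrightarrow> algebraic_int (f i :: complex)) \<Longrightarrow> algebraic_int (sum f I)"
  by (induction I rule: infinite_finite_induct) (auto intro: algebraic_int_add)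

lemma algebraic_int_power: "algebraic_int (x :: complex) \<Longrightarrow> algebraic_int (x ^ n)"
  by (induction n) (auto intro: algebraic_int_mult)

lemma algebraic_int_integrally_closed:
  assumes p: "lead_coeff p = 1" "\<And>i. algebraic_int (coeff p i)" "poly p (x :: complex) = 0"
  shows "algebraic_int x"
proof -
  obtain V where V: "finite V" "1 \<in> V" "set (coeffs p) \<subseteq> Zstab V"
    by (rule Zstab_finite_algebraic_int[of "set (coeffs p)"])
      (use p(2) in \<open>auto simp: coeffs_def split: if_splits\<close>)
  have "coeff p i \<in> Zstab V" for i
    using V(3) Zstab_of_int[OF V(1), of 0] coeff_in_coeffs[of p i]
    by (cases "p = 0"; cases "i \<le> degree p") (auto simp: coeff_eq_0)
  then obtain W where "finite W" "1 \<in> W" "x \<in> Zstab W"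
    using Zstab_adjoin_root[OF V(1,2) p(1) _ p(3)] by metis
  then show ?thesis by (rule algebraic_int_if_Zstab)
qed

text \<open>With n the degree and a the leading coefficient, a^(n-1) p(x) is a monic polynomial in a
  x whose lower coefficients are those of \<open>p\<close> times powers of a. This polynomial is
  \<open>q\<close>.\<close>

lemma algebraic_int_lead_coeff_mult_root:
  assumes p: "p \<noteq> 0" "\<And>i. algebraic_int (coeff p i)" "poly p (x :: complex) = 0"
  shows "algebraic_int (lead_coeff p * x)"
proof -
  define n a where "n = degree p" and "a = lead_coeff p"
  have n: "n > 0"
    using p by (intro Nat.gr0I) (auto simp: n_def elim!: degree_eq_zeroE)
  define q where "q = (\<Sum>i<n. monom (coeff p i * a ^ (n - 1 - i)) i) + monom 1 n"
  have cq: "coeff q i = (if i < n then coeff p i * a ^ (n - 1 - i) else if i = n then 1 else 0)" for i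
    by (auto simp: q_def coeff_sum sum.delta)
  have "degree q = n"
    by (rule antisym[OF degree_le le_degree]) (auto simp: cq)
  then have lead: "lead_coeff q = 1" by (simp add: cq)
  have int: "algebraic_int (coeff q i)" for i
    using p(2) by (auto simp: cq a_def intro!: algebraic_int_mult algebraic_int_power)
  have "poly q (a * x) = (\<Sum>i<n. coeff p i * a ^ (n - 1 - i) * (a * x) ^ i) + (a * x) ^ n"
    by (simp add: q_def poly_sum poly_monom)
  also have "(\<Sum>i<n. coeff p i * a ^ (n - 1 - i) * (a * x) ^ i) =
      (\<Sum>i<n. a ^ (n - 1) * (coeff p i * x ^ i))"
  proof (rule sum.cong[OF refl])
    fix i assume "i \<in> {..<n}"
    then have "a ^ (n - 1) = a ^ (n - 1 - i) * a ^ i" by (simp flip: power_add)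
    then show "coeff p i * a ^ (n - 1 - i) * (a * x) ^ i = a ^ (n - 1) * (coeff p i * x ^ i)"
      by (simp add: power_mult_distrib mult_ac)
  qed
  also have "(a * x) ^ n = a ^ (n - 1) * (a * x ^ n)"
    using n by (cases n) (simp_all add: power_mult_distrib mult_ac)
  also have "(\<Sum>i<n. a ^ (n - 1) * (coeff p i * x ^ i)) + a ^ (n - 1) * (a * x ^ n) =
      a ^ (n - 1) * poly p x"
    unfolding poly_altdef n_def a_def
    by (simp add: lessThan_Suc_atMost[symmetric] sum_distrib_left ring_distribs)
  finally have "poly q (a * x) = 0" using p by simp
  with lead int have "algebraic_int (a * x)"
    by (rule algebraic_int_integrally_closed)
  then show ?thesis by (simp add: a_def)
qed

text \<open>Integer denominators transfer closure under sums and products from algebraic integers to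
  algebraic numbers.\<close>

lemma algebraic_imp_multiple_algebraic_int:
  assumes "algebraic (x :: complex)"
  obtains k :: int where "k \<noteq> 0" "algebraic_int (of_int k * x)"
proof -
  obtain p where p: "\<And>i. coeff p i \<in> \<int>" "p \<noteq> 0" "poly p x = 0"
    using assms by (rule algebraicE) blast
  have *: "algebraic_int (lead_coeff p * x)"
    using p by (intro algebraic_int_lead_coeff_mult_root) (auto intro: int_imp_algebraic_int)
  obtain k where "lead_coeff p = of_int k" using p(1) by (metis Ints_cases)
  with p(2) * show ?thesis by (intro that[of k]) auto
qed

lemma algebraic_if_multiple_algebraic_int:
  assumes "algebraic_int (of_int k * x :: complex)" "k \<noteq> 0"
  shows "algebraic x"
proof -
  obtain p where p: "\<And>i. coeff p i \<in> \<int>" "p \<noteq> 0" "poly p (of_int k * x) = 0"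
    using algebraic_int_imp_algebraic[OF assms(1)] by (rule algebraicE) blast
  let ?q = "pcompose p [:0, of_int k:]"
  have "\<And>i. coeff ?q i \<in> \<int>"
    using p(1) by (auto simp: coeff_pcompose_linear)
  moreover have "?q \<noteq> 0"
    using p(2) assms(2) by (simp add: pcompose_eq_0_iff)
  moreover have "poly ?q x = 0"
    using p(3) by (simp add: poly_pcompose mult.commute)
  ultimately show ?thesis by (rule algebraicI)
qed

lemma algebraic_add:
  assumes "algebraic x" "algebraic (y :: complex)"
  shows "algebraic (x + y)"
proof -
  obtain k l :: int where k: "k \<noteq> 0" "algebraic_int (of_int k * x)"
    and l: "l \<noteq> 0" "algebraic_int (of_int l * y)"
    using assms algebraic_imp_multiple_algebraic_int by metis
  have "of_int (k * l) * (x + y) = of_int l * (of_int k * x) + of_int k * (of_int l * y)"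
    by (simp add: algebra_simps)
  also have "algebraic_int \<dots>"
    by (intro algebraic_int_add algebraic_int_mult[OF _ k(2)] algebraic_int_mult[OF _ l(2)]) auto
  finally show ?thesis
    by (rule algebraic_if_multiple_algebraic_int) (use k l in auto)
qed

lemma algebraic_mult:
  assumes "algebraic x" "algebraic (y :: complex)"
  shows "algebraic (x * y)"
proof -
  obtain k l :: int where k: "k \<noteq> 0" "algebraic_int (of_int k * x)"
    and l: "l \<noteq> 0" "algebraic_int (of_int l * y)"
    using assms algebraic_imp_multiple_algebraic_int by metis
  have "of_int (k * l) * (x * y) = (of_int k * x) * (of_int l * y)"
    by (simp add: algebra_simps)
  also have "algebraic_int \<dots>"
    using k(2) l(2) by (rule algebraic_int_mult)
  finally show ?thesis
    by (rule algebraic_if_multiple_algebraic_int) (use k l in auto)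
qed

text \<open>Induction on the degree of \<open>q\<close>. Its leading coefficient a is that of the
  product, and a x is integral because \<open>x\<close> is a root of the product. So the leading
  term \<open>m\<close> of \<open>q\<close>, multiplied by X - x, has integral coefficients and can
  be subtracted, which lowers the degree.\<close>

lemma algebraic_int_coeff_quotient_root:
  assumes "\<And>i. algebraic_int (coeff ([:- x, 1:] * q) i)"
  shows "algebraic_int (coeff q i :: complex)"
  using assms
proof (induction "degree q" arbitrary: q i rule: less_induct)
  case less
  show ?case
  proof (cases "q = 0")
    case False
    define p where "p = [:- x, 1:] * q"
    define a where "a = lead_coeff q"
    have p: "p \<noteq> 0" "poly p x = 0" "lead_coeff p = a"
      using False by (simp_all add: p_def a_def lead_coeff_mult del: mult_pCons_left)
    have ax: "algebraic_int (a * x)"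
      using algebraic_int_lead_coeff_mult_root[OF p(1) _ p(2)] less.prems p(3) by (simp add: p_def)
    have a: "algebraic_int a"
      using less.prems p(3) by (metis p_def)
    define m where "m = monom a (degree q)"
    have "algebraic_int (coeff ([:- x, 1:] * m) i)" for i
      using a ax by (auto simp: m_def coeff_pCons coeff_monom mult.commute split: nat.splits)
    then have step: "algebraic_int (coeff ([:- x, 1:] * (q - m)) i)" for i
      using less.prems by (simp add: right_diff_distrib algebraic_int_diff del: mult_pCons_left)
    have "algebraic_int (coeff (q - m) i)"
    proof (cases "degree q = 0")
      case True
      then have "q - m = 0" by (auto simp: m_def a_def monom_0 elim: degree_eq_zeroE)
      then show ?thesis by simp
    next
      case False
      have "degree (q - m) < degree q"
        using False by (intro degree_lessI) (auto simp: m_def a_def coeff_eq_0)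
      then show ?thesis using step by (rule less.hyps)
    qed
    moreover have "algebraic_int (coeff m i)" using a by (simp add: m_def)
    ultimately have "algebraic_int (coeff (q - m) i + coeff m i)" by (rule algebraic_int_add)
    then show ?thesis by simp
  qed simp
qed

lemma algebraic_int_coeff_quotient_roots:
  assumes "\<And>i. algebraic_int (coeff ((\<Prod>x\<in>#M. [:- x, 1:]) * q) i)"
  shows "algebraic_int (coeff q i :: complex)"
  using assms
proof (induction M arbitrary: i)
  case (add x M)
  have "algebraic_int (coeff ((\<Prod>x\<in>#M. [:- x, 1:]) * q) i)" for i
    by (rule algebraic_int_coeff_quotient_root[of x]) (use add.prems in \<open>simp add: mult.assoc del: mult_pCons_left\<close>)
  then show ?case by (rule add.IH)
qed simp

text \<open>Cancel from \<open>p\<close> the linear factors of the remaining roots \<open>M\<close>,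
  counted with multiplicity. The quotient \<open>q\<close> still has integral coefficients, and its
  constant term is the desired number up to sign.\<close>

lemma algebraic_int_lead_coeff_mult_prod_roots:
  assumes p: "p \<noteq> 0" "\<And>i. algebraic_int (coeff p i)"
    and T: "\<And>z. z \<in> T \<Longrightarrow> poly p z = 0"
  shows "algebraic_int (lead_coeff p * \<Prod>T :: complex)"
proof -
  have "finite T"
    by (rule finite_subset[OF _ poly_roots_finite[OF p(1)]]) (use T in auto)
  then have "mset_set T \<subseteq># proots p"
    using T p(1) by (auto simp: subseteq_mset_def count_mset_set' order_root Suc_le_eq)
  then obtain M where M: "proots p = mset_set T + M"
    by (metis subset_mset.add_diff_inverse)
  define q where "q = Polynomial.smult (lead_coeff p) (\<Prod>x\<in>#mset_set T. [:- x, 1:])"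
  have "p = Polynomial.smult (lead_coeff p) (\<Prod>x\<in>#proots p. [:- x, 1:])"
    by (rule complex_poly_decompose_multiset[symmetric])
  also have "\<dots> = (\<Prod>x\<in>#M. [:- x, 1:]) * q"
    by (simp add: M q_def mult.commute)
  finally have "algebraic_int (coeff q 0)"
    using algebraic_int_coeff_quotient_roots[of M q 0] p(2) by metis
  moreover have "coeff q 0 = lead_coeff p * (\<Prod>x\<in>T. - x)"
    by (simp add: q_def poly_prod flip: poly_0_coeff_0 prod_unfold_prod_mset)
  moreover have "(\<Prod>x\<in>T. - x) = \<Prod>T \<or> (\<Prod>x\<in>T. - x) = - \<Prod>T"
    using prod_uminus[of "\<lambda>x. x" T] by (cases "even (card T)") auto
  ultimately show ?thesis by auto
qed

section \<open>Automorphisms of the field of algebraic numbers\<close>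

lemma algebraic_diff: "algebraic x \<Longrightarrow> algebraic (y :: complex) \<Longrightarrow> algebraic (x - y)"
  using algebraic_add[of x "- y"] by auto

lemma algebraic_prod:
  "(\<And>i. i \<in> I \<Longrightarrow> algebraic (f i :: complex)) \<Longrightarrow> algebraic (prod f I)"
  by (induction I rule: infinite_finite_induct) (auto intro: algebraic_mult)

lemma algebraic_power: "algebraic (x :: complex) \<Longrightarrow> algebraic (x ^ n)"
  by (induction n) (auto intro: algebraic_mult)

lemma algebraic_poly:
  "(\<And>i. algebraic (coeff p i)) \<Longrightarrow> algebraic x \<Longrightarrow> algebraic (poly p (x :: complex))"
proof (induction p)
  case (pCons a p)
  have "algebraic a" using pCons.prems(1)[of 0] by simp
  moreover have "algebraic (coeff p i)" for i using pCons.prems(1)[of "Suc i"] by simp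
  ultimately show ?case using pCons by (auto intro!: algebraic_add algebraic_mult)
qed simp

text \<open>The graph of a homomorphism into \<open>\<complex>\<close> from a subring of the algebraic numbers containing \<open>\<rat>\<close>.\<close>
definition embedding :: "(complex \<times> complex) set \<Rightarrow> bool" where
  "embedding r \<longleftrightarrow> (\<forall>q\<in>\<rat>. (q, q) \<in> r) \<and>
     (\<forall>x y x' y'. (x, y) \<in> r \<longrightarrow> (x', y') \<in> r \<longrightarrow> (x + x', y + y') \<in> r \<and> (x * x', y * y') \<in> r) \<and>
     (\<forall>y. (0, y) \<in> r \<longrightarrow> y = 0) \<and> (\<forall>x y. (x, y) \<in> r \<longrightarrow> algebraic x)"

lemma embedding_Rats: "embedding r \<Longrightarrow> q \<in> \<rat> \<Longrightarrow> (q, q) \<in> r"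
  and embedding_add: "embedding r \<Longrightarrow> (x, y) \<in> r \<Longrightarrow> (x', y') \<in> r \<Longrightarrow> (x + x', y + y') \<in> r"
  and embedding_mult: "embedding r \<Longrightarrow> (x, y) \<in> r \<Longrightarrow> (x', y') \<in> r \<Longrightarrow> (x * x', y * y') \<in> r"
  and embedding_zeroD: "embedding r \<Longrightarrow> (0, y) \<in> r \<Longrightarrow> y = 0"
  and embedding_algebraic: "embedding r \<Longrightarrow> (x, y) \<in> r \<Longrightarrow> algebraic x"
  unfolding embedding_def by blast+

lemma embedding_minus:
  assumes "embedding r" "(x, y) \<in> r"
  shows "(- x, - y) \<in> r"
  using embedding_mult[OF assms(1) embedding_Rats[OF assms(1), of "-1"] assms(2)] by simp

lemma embedding_diff:
  "embedding r \<Longrightarrow> (x, y) \<in> r \<Longrightarrow> (x', y') \<in> r \<Longrightarrow> (x - x', y - y') \<in> r"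
  using embedding_add[of r x y "- x'" "- y'"] embedding_minus[of r x' y'] by simp

text \<open>Single-valuedness comes from the condition on pairs \<open>(0, y)\<close>, applied to
  the difference of the two pairs.\<close>

lemma embedding_unique: "embedding r \<Longrightarrow> (x, y) \<in> r \<Longrightarrow> (x, y') \<in> r \<Longrightarrow> y = y'"
  using embedding_diff[of r x y x y'] embedding_zeroD[of r "y - y'"] by simp

lemma embedding_sum:
  assumes "embedding r" "\<And>i. i \<in> I \<Longrightarrow> (f i, g i) \<in> r"
  shows "(sum f I, sum g I) \<in> r"
  using assms(2)
  by (induction I rule: infinite_finite_induct)
    (auto intro!: embedding_add[OF assms(1)] embedding_Rats[OF assms(1)])

text \<open>The second polynomial is the image of the first under the homomorphism with graph
  \<open>r\<close>; a relation fits because \<open>r\<close> is only partially defined.\<close>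

definition poly_rel :: "(complex \<times> complex) set \<Rightarrow> complex poly \<Rightarrow> complex poly \<Rightarrow> bool" where
  "poly_rel r p q \<longleftrightarrow> (\<forall>i. (coeff p i, coeff q i) \<in> r)"

lemma poly_rel_Rats: "embedding r \<Longrightarrow> (\<And>i. coeff p i \<in> \<rat>) \<Longrightarrow> poly_rel r p p"
  by (auto simp: poly_rel_def intro: embedding_Rats)

lemma poly_rel_zeroD:
  assumes "embedding r" "poly_rel r 0 q"
  shows "q = 0"
  using assms embedding_zeroD by (auto simp: poly_rel_def poly_eq_iff)

lemma poly_rel_monom: "embedding r \<Longrightarrow> (a, b) \<in> r \<Longrightarrow> poly_rel r (monom a n) (monom b n)"
  by (auto simp: poly_rel_def intro: embedding_Rats)

lemma poly_rel_diff:
  "embedding r \<Longrightarrow> poly_rel r p q \<Longrightarrow> poly_rel r p' q' \<Longrightarrow> poly_rel r (p - p') (q - q')"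
  by (auto simp: poly_rel_def intro: embedding_diff)

lemma poly_rel_add:
  "embedding r \<Longrightarrow> poly_rel r p q \<Longrightarrow> poly_rel r p' q' \<Longrightarrow> poly_rel r (p + p') (q + q')"
  by (auto simp: poly_rel_def intro: embedding_add)

lemma poly_rel_mult:
  "embedding r \<Longrightarrow> poly_rel r p q \<Longrightarrow> poly_rel r p' q' \<Longrightarrow> poly_rel r (p * p') (q * q')"
  by (auto simp: poly_rel_def coeff_mult intro!: embedding_sum embedding_mult)

lemma poly_rel_prod:
  assumes "embedding r" "\<And>i. i \<in> I \<Longrightarrow> poly_rel r (f i) (g i)"
  shows "poly_rel r (prod f I) (prod g I)"
  using assms(2)
  by (induction I rule: infinite_finite_induct)
    (auto intro!: poly_rel_mult[OF assms(1)] poly_rel_Rats[OF assms(1)] simp: coeff_1)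

lemma poly_rel_eval:
  assumes "embedding r" "poly_rel r p q" "(x, y) \<in> r"
  shows "(poly p x, poly q y) \<in> r"
  using assms(2)
proof (induction p arbitrary: q)
  case 0
  then have "q = 0" using poly_rel_zeroD[OF assms(1)] by simp
  then show ?case using embedding_Rats[OF assms(1)] by simp
next
  case (pCons a p)
  obtain b q' where q: "q = pCons b q'" by (cases q)
  have "(coeff (pCons a p) i, coeff (pCons b q') i) \<in> r" for i
    using pCons.prems by (simp add: poly_rel_def q)
  from this[of 0] this[of "Suc i" for i] have "(a, b) \<in> r" "poly_rel r p q'"
    by (auto simp: poly_rel_def)
  with pCons.IH assms(3) show ?case
    by (auto simp: q intro!: embedding_add[OF assms(1)] embedding_mult[OF assms(1)])
qed

text \<open>The domain is only assumed to be a ring, but its elements are algebraic. A rational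
  equation c + x q(x) = 0 with c non-zero writes the inverse of \<open>x\<close> as a rational
  polynomial in \<open>x\<close>, so the domain already contains it.\<close>

lemma embedding_inverse:
  assumes r: "embedding r" "(x, y) \<in> r" and "x \<noteq> 0"
  shows "(inverse x, inverse y) \<in> r"
proof -
  obtain p' where p': "poly (map_poly of_int p') x = 0" "coeff p' 0 \<noteq> 0"
    using algebraicE'_nonzero[OF embedding_algebraic[OF r] \<open>x \<noteq> 0\<close>] by metis
  define p where "p = (map_poly of_int p' :: complex poly)"
  obtain c q where p: "p = pCons c q" by (cases p)
  have cp: "coeff p i \<in> \<rat>" for i by (simp add: p_def coeff_map_poly)
  from cp[of 0] cp[of "Suc i" for i] have c: "c \<in> \<rat>" and q: "\<And>i. coeff q i \<in> \<rat>" by (auto simp: p)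
  have "c = of_int (coeff p' 0)" using p by (metis coeff_map_poly coeff_pCons_0 of_int_0 p_def)
  then have "c \<noteq> 0" using p' by simp
  have "c + x * poly q x = 0" using p' by (simp add: p flip: p_def)
  then have inv: "inverse x = - inverse c * poly q x"
    using \<open>x \<noteq> 0\<close> \<open>c \<noteq> 0\<close> by (simp add: field_simps add_eq_0_iff)
  have "(- inverse c * poly q x, - inverse c * poly q y) \<in> r"
    using c q by (intro embedding_mult[OF r(1)] embedding_Rats[OF r(1)] poly_rel_eval[OF r(1)]
        poly_rel_Rats[OF r(1)] r(2)) auto
  then obtain u where u: "(inverse x, u) \<in> r" by (auto simp: inv)
  have "(1, y * u) \<in> r" using embedding_mult[OF r u] \<open>x \<noteq> 0\<close> by simp
  then have "y * u = 1" using embedding_unique[OF r(1)] embedding_Rats[OF r(1), of 1] by fastforce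
  then have "inverse y = u" by (metis inverse_unique)
  with u show ?thesis by simp
qed

section \<open>Extension of embeddings to all algebraic numbers\<close>

definition minimal_rel :: "(complex \<times> complex) set \<Rightarrow> complex \<Rightarrow> complex poly \<Rightarrow> complex poly \<Rightarrow> bool" where
  "minimal_rel r z p q \<longleftrightarrow> poly_rel r p q \<and> lead_coeff p = 1 \<and> poly p z = 0 \<and>
     (\<forall>h k. poly_rel r h k \<longrightarrow> h \<noteq> 0 \<longrightarrow> poly h z = 0 \<longrightarrow> degree p \<le> degree h)"

text \<open>Here \<open>p\<close> acts as the minimal polynomial of \<open>z\<close> over the domain
  of \<open>r\<close>, and \<open>q\<close> as its image, whose roots are the admissible images of
  \<open>z\<close>. Candidates exist because rational polynomials are related to themselves; one of
  least degree is then made monic.\<close>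

lemma minimal_rel_exists:
  assumes r: "embedding r" and z: "algebraic z"
  obtains p q where "minimal_rel r z p q"
proof -
  let ?P = "\<lambda>(h, k). poly_rel r h k \<and> h \<noteq> 0 \<and> poly h z = 0"
  obtain p0 where "\<And>i. coeff p0 i \<in> \<rat>" "p0 \<noteq> 0" "poly p0 z = 0"
    using z unfolding algebraic_altdef by blast
  then have "?P (p0, p0)" using poly_rel_Rats[OF r, of p0] by auto
  from arg_min_nat_lemma[of ?P, OF this, of "\<lambda>(h, k). degree h"]
  obtain h k where hk: "?P (h, k)" and
    min: "\<And>h' k'. ?P (h', k') \<Longrightarrow> degree h \<le> degree h'"
    by (cases "arg_min (\<lambda>(h, k). degree h) ?P") auto
  \<comment> \<open>\<open>b\<close> inverts the coefficient of \<open>k\<close> at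
    \<open>degree h\<close>, because that is the partner of the leading coefficient of
    \<open>h\<close>.\<close>
  define a b where "a = inverse (lead_coeff h)" and "b = inverse (coeff k (degree h))"
  have "(a, b) \<in> r"
    unfolding a_def b_def using hk by (intro embedding_inverse[OF r]) (auto simp: poly_rel_def)
  then have "poly_rel r (Polynomial.smult a h) (Polynomial.smult b k)"
    using hk by (auto simp: poly_rel_def intro: embedding_mult[OF r])
  moreover have "a \<noteq> 0" using hk by (auto simp: a_def)
  ultimately have "minimal_rel r z (Polynomial.smult a h) (Polynomial.smult b k)"
    unfolding minimal_rel_def using hk min by (auto simp: a_def)
  then show ?thesis by (rule that)
qed

lemma minimal_rel_degree:
  assumes "embedding r" "minimal_rel r z p q"
  shows "degree p > 0" "degree q > 0"
proof -
  show p: "degree p > 0"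
    using assms(2) by (intro Nat.gr0I) (auto simp: minimal_rel_def elim!: degree_eq_zeroE)
  have "(coeff p (degree p), coeff q (degree p)) \<in> r" "coeff p (degree p) = 1"
    using assms(2) unfolding minimal_rel_def poly_rel_def by blast+
  then have "coeff q (degree p) = 1"
    using embedding_unique[OF assms(1) _ embedding_Rats[OF assms(1), of 1]] by simp
  then have "degree p \<le> degree q" by (intro le_degree) auto
  with p show "degree q > 0" by simp
qed

text \<open>Long division of \<open>h\<close> by \<open>p\<close>, one leading term at a time, is
  mirrored by the same operations on \<open>k\<close> and \<open>q\<close>. Minimality of
  \<open>p\<close> allows each step until \<open>h\<close> is 0. This makes the assignment of k(w)
  to h(z) well defined.\<close>

lemma minimal_rel_root:
  assumes r: "embedding r" and m: "minimal_rel r z p q" and w: "poly q w = 0"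
    and "poly_rel r h k" "poly h z = 0"
  shows "poly k w = 0"
  using assms(4,5)
proof (induction "degree h" arbitrary: h k rule: less_induct)
  case less
  show ?case
  proof (cases "h = 0")
    case True
    then have "k = 0" using poly_rel_zeroD[OF r] less.prems by blast
    then show ?thesis by simp
  next
    case False
    have p: "poly_rel r p q" "lead_coeff p = 1" "poly p z = 0" "degree p \<le> degree h"
      using m False less.prems unfolding minimal_rel_def by blast+
    define a b d where "a = lead_coeff h" and "b = coeff k (degree h)" and "d = degree h - degree p"
    define h' k' where "h' = h - monom a d * p" and "k' = k - monom b d * q"
    have "(a, b) \<in> r" using less.prems by (auto simp: poly_rel_def a_def b_def)
    then have rel: "poly_rel r h' k'"
      unfolding h'_def k'_def
      by (intro poly_rel_diff poly_rel_mult poly_rel_monom r less.prems p)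
    have "p \<noteq> 0" using p by auto
    then have deg: "degree (monom a d * p) = degree h"
      using False p(4) by (simp add: degree_mult_eq degree_monom_eq a_def d_def)
    have lead: "coeff (monom a d * p) (degree h) = coeff h (degree h)"
      using deg p(2) by (metis a_def lead_coeff_monom lead_coeff_mult mult.right_neutral)
    have "degree h > 0" using minimal_rel_degree[OF r m] p(4) by simp
    then have "degree h' < degree h"
      unfolding h'_def using deg lead
      by (intro degree_lessI) (auto simp: coeff_eq_0 le_less simp del: coeff_monom_mult)
    moreover have "poly h' z = 0" using less.prems p by (simp add: h'_def)
    ultimately have "poly k' w = 0" using less.hyps rel by blast
    then show ?thesis using w by (simp add: k'_def)
  qed
qed

lemma embedding_adjoin:
  assumes r: "embedding r" and m: "minimal_rel r z p q" and z: "algebraic z" and w: "poly q w = 0"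
  obtains s where "embedding s" "r \<subseteq> s" "(z, w) \<in> s"
proof -
  define s where "s = {(poly h z, poly k w) |h k. poly_rel r h k}"
  have sI: "(poly h z, poly k w) \<in> s" if "poly_rel r h k" for h k
    using that by (auto simp: s_def)
  have const: "(x, y) \<in> s" if "(x, y) \<in> r" for x y
    using sI[of "monom x 0" "monom y 0"] poly_rel_monom[OF r that] by (simp add: poly_monom)
  have "embedding s"
    unfolding embedding_def
  proof (intro conjI ballI allI impI)
    fix q :: complex assume "q \<in> \<rat>"
    then show "(q, q) \<in> s" using const embedding_Rats[OF r] by blast
  next
    fix x y x' y' assume "(x, y) \<in> s" "(x', y') \<in> s"
    then obtain h k h' k' where *: "poly_rel r h k" "poly_rel r h' k'"
      "x = poly h z" "y = poly k w" "x' = poly h' z" "y' = poly k' w"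
      by (auto simp: s_def)
    show "(x + x', y + y') \<in> s"
      using sI[OF poly_rel_add[OF r *(1,2)]] by (simp add: *)
    show "(x * x', y * y') \<in> s"
      using sI[OF poly_rel_mult[OF r *(1,2)]] by (simp add: *)
  next
    fix y assume "(0, y) \<in> s"
    then obtain h k where "poly_rel r h k" "poly h z = 0" "y = poly k w"
      unfolding s_def by force
    then show "y = 0" using minimal_rel_root[OF r m w] by simp
  next
    fix x y assume "(x, y) \<in> s"
    then show "algebraic x"
      using z embedding_algebraic[OF r]
      by (auto simp: s_def poly_rel_def intro!: algebraic_poly)
  qed
  moreover have "(z, w) \<in> s"
    using sI[OF poly_rel_monom[OF r embedding_Rats[OF r, of 1], of 1]] by (simp add: poly_monom)
  moreover have "r \<subseteq> s" using const by auto
  ultimately show ?thesis using that by blast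
qed

text \<open>Zorn's lemma applied to the extensions of \<open>r\<close>. A maximal extension reaches
  every algebraic \<open>z\<close>: the image of its minimal polynomial has a complex root, so
  \<open>z\<close> can be adjoined.\<close>

lemma embedding_maximal:
  assumes "embedding r"
  obtains s where "embedding s" "r \<subseteq> s" "Domain s = {x. algebraic x}"
proof -
  let ?A = "{s. embedding s \<and> r \<subseteq> s}"
  have "\<exists>M\<in>?A. \<forall>X\<in>?A. M \<subseteq> X \<longrightarrow> X = M"
  proof (rule subset_Zorn_nonempty)
    fix C assume C: "C \<noteq> {}" "subset.chain ?A C"
    have emb: "embedding s" "r \<subseteq> s" if "s \<in> C" for s
      using C that by (auto simp: subset.chain_def)
    \<comment> \<open>Since \<open>C\<close> is a chain, the ring conditions for two pairs can be
      checked inside a single member.\<close>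
    have two: "\<exists>s\<in>C. a \<in> s \<and> b \<in> s" if "a \<in> \<Union>C" "b \<in> \<Union>C" for a b
      using C that unfolding subset.chain_def by blast
    have "embedding (\<Union>C)"
      unfolding embedding_def
    proof (intro conjI ballI allI impI)
      fix q :: complex assume "q \<in> \<rat>"
      then show "(q, q) \<in> \<Union>C" using C(1) emb(1) embedding_Rats by blast
    next
      fix x y x' y' assume "(x, y) \<in> \<Union>C" "(x', y') \<in> \<Union>C"
      then obtain s where s: "s \<in> C" "(x, y) \<in> s" "(x', y') \<in> s" using two by blast
      show "(x + x', y + y') \<in> \<Union>C" "(x * x', y * y') \<in> \<Union>C"
        using s embedding_add[OF emb(1)[OF s(1)] s(2,3)] embedding_mult[OF emb(1)[OF s(1)] s(2,3)]
        by blast+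
    next
      fix y assume "(0, y) \<in> \<Union>C"
      then show "y = 0" using emb(1) embedding_zeroD by blast
    next
      fix x y assume "(x, y) \<in> \<Union>C"
      then show "algebraic x" using emb(1) embedding_algebraic by blast
    qed
    with C(1) emb show "\<Union>C \<in> ?A" by blast
  qed (use assms in auto)
  then obtain M where MA: "M \<in> ?A" and maxA: "\<forall>X\<in>?A. M \<subseteq> X \<longrightarrow> X = M" by (rule bexE)
  from MA have M: "embedding M" "r \<subseteq> M" by simp_all
  have max: "X = M" if "embedding X" "M \<subseteq> X" for X
    using maxA M(2) that by (simp add: subset_trans)
  have "z \<in> Domain M" if z: "algebraic z" for z
  proof -
    obtain p q where m: "minimal_rel M z p q" using minimal_rel_exists[OF M(1) z] .
    obtain w where w: "poly q w = 0"
      using alg_closed_imp_poly_has_root minimal_rel_degree[OF M(1) m] by blast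
    obtain s where "embedding s" "M \<subseteq> s" "(z, w) \<in> s"
      using embedding_adjoin[OF M(1) m z w] .
    then show ?thesis using max[of s] by (simp add: DomainI)
  qed
  then have "Domain M = {x. algebraic x}" using embedding_algebraic[OF M(1)] by blast
  with M show ?thesis by (rule that)
qed

text \<open>The absolute Galois group; extending by the identity outside the algebraic numbers makes
  its elements bijections of the whole type.\<close>
definition Gal :: "(complex \<Rightarrow> complex) set" where
  "Gal = {\<sigma>. (\<forall>x. \<not> algebraic x \<longrightarrow> \<sigma> x = x) \<and> embedding {(x, \<sigma> x) |x. algebraic x}}"

text \<open>Isomorphism extension for the algebraic closure. Only a homomorphism of the algebraic
  numbers is built here; its bijectivity is \<open>Gal_bij\<close>.\<close>

lemma Gal_extends_embedding:
  assumes "embedding r"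
  obtains \<sigma> where "\<sigma> \<in> Gal" "\<And>x y. (x, y) \<in> r \<Longrightarrow> \<sigma> x = y"
proof -
  obtain s where s: "embedding s" "r \<subseteq> s" "Domain s = {x. algebraic x}"
    using embedding_maximal[OF assms] .
  define \<sigma> where "\<sigma> x = (if algebraic x then THE y. (x, y) \<in> s else x)" for x
  have \<sigma>: "\<sigma> x = y" if "(x, y) \<in> s" for x y
    using that embedding_algebraic[OF s(1)] embedding_unique[OF s(1)] by (auto simp: \<sigma>_def)
  have "s = {(x, \<sigma> x) |x. algebraic x}"
  proof (intro equalityI subsetI)
    fix a assume "a \<in> {(x, \<sigma> x) |x. algebraic x}"
    then obtain x where x: "a = (x, \<sigma> x)" "x \<in> Domain s" using s(3) by auto
    then obtain y where "(x, y) \<in> s" by (elim DomainE)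
    with x show "a \<in> s" using \<sigma> by simp
  qed (use \<sigma> embedding_algebraic[OF s(1)] in auto)
  then have "\<sigma> \<in> Gal" using s(1) by (simp add: Gal_def) (simp add: \<sigma>_def)
  moreover have "\<sigma> x = y" if "(x, y) \<in> r" for x y
    using \<sigma> s(2) that by auto
  ultimately show ?thesis by (rule that)
qed

context
  fixes \<sigma> assumes \<sigma>: "\<sigma> \<in> Gal"
begin

lemma Gal_embedding: "embedding {(x, \<sigma> x) |x. algebraic x}"
  using \<sigma> by (simp add: Gal_def)

lemma Gal_not_algebraic: "\<not> algebraic x \<Longrightarrow> \<sigma> x = x"
  using \<sigma> by (simp add: Gal_def)

lemma Gal_Rats: "q \<in> \<rat> \<Longrightarrow> \<sigma> q = q"
  using embedding_Rats[OF Gal_embedding] by auto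

lemma Gal_add: "algebraic x \<Longrightarrow> algebraic y \<Longrightarrow> \<sigma> (x + y) = \<sigma> x + \<sigma> y"
  using embedding_add[OF Gal_embedding, of x "\<sigma> x" y "\<sigma> y"] by auto

lemma Gal_mult: "algebraic x \<Longrightarrow> algebraic y \<Longrightarrow> \<sigma> (x * y) = \<sigma> x * \<sigma> y"
  using embedding_mult[OF Gal_embedding, of x "\<sigma> x" y "\<sigma> y"] by auto

lemma Gal_diff: "algebraic x \<Longrightarrow> algebraic y \<Longrightarrow> \<sigma> (x - y) = \<sigma> x - \<sigma> y"
  using embedding_diff[OF Gal_embedding, of x "\<sigma> x" y "\<sigma> y"] by auto

lemma Gal_inverse: "algebraic x \<Longrightarrow> \<sigma> (inverse x) = inverse (\<sigma> x)"
  using embedding_inverse[OF Gal_embedding, of x "\<sigma> x"] Gal_Rats[of 0] by (cases "x = 0") auto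

lemma Gal_prod: "(\<And>i. i \<in> I \<Longrightarrow> algebraic (f i)) \<Longrightarrow> \<sigma> (prod f I) = (\<Prod>i\<in>I. \<sigma> (f i))"
  by (induction I rule: infinite_finite_induct) (auto simp: Gal_Rats Gal_mult algebraic_prod)

lemma Gal_power: "algebraic x \<Longrightarrow> \<sigma> (x ^ n) = \<sigma> x ^ n"
  by (induction n) (auto simp: Gal_Rats Gal_mult algebraic_power)

lemma Gal_root:
  assumes "\<And>i. coeff p i \<in> \<rat>" "poly p x = 0"
  shows "poly p (\<sigma> x) = 0"
proof (cases "algebraic x")
  case True
  have "(poly p x, poly p (\<sigma> x)) \<in> {(x, \<sigma> x) |x. algebraic x}"
    using True assms(1) by (intro poly_rel_eval Gal_embedding poly_rel_Rats) auto
  then show ?thesis using assms(2) Gal_Rats[of 0] by auto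
qed (use assms(2) Gal_not_algebraic in auto)

lemma Gal_algebraic: "algebraic x \<Longrightarrow> algebraic (\<sigma> x)"
  by (metis algebraic_altdef Gal_root)

lemma Gal_eq_0_iff: "\<sigma> x = 0 \<longleftrightarrow> x = 0"
proof
  assume 0: "\<sigma> x = 0"
  show "x = 0"
  proof (rule ccontr)
    assume "x \<noteq> 0"
    have x: "algebraic x" using 0 Gal_not_algebraic by force
    have "\<sigma> (x * inverse x) = 0" using x 0 by (subst Gal_mult) auto
    with \<open>x \<noteq> 0\<close> show False using Gal_Rats[of 1] by simp
  qed
qed (use Gal_Rats[of 0] in auto)

lemma Gal_inj: "inj \<sigma>"
proof (rule injI)
  fix x y assume eq: "\<sigma> x = \<sigma> y"
  have alg: "algebraic x \<longleftrightarrow> algebraic y"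
    using eq by (metis Gal_algebraic Gal_not_algebraic)
  show "x = y"
  proof (cases "algebraic x")
    case True
    then have "\<sigma> (x - y) = 0" using alg eq by (simp add: Gal_diff)
    then show ?thesis using Gal_eq_0_iff by simp
  next
    case False
    then show ?thesis using alg eq by (simp add: Gal_not_algebraic)
  qed
qed

lemma Gal_permutes_roots:
  assumes "\<And>i. coeff p i \<in> \<rat>" "p \<noteq> 0"
  shows "\<sigma> ` {x. poly p x = 0} = {x. poly p x = 0}"
proof (rule endo_inj_surj)
  show "inj_on \<sigma> {x. poly p x = 0}" using Gal_inj by (rule inj_on_subset) simp
qed (use Gal_root[of p] assms poly_roots_finite in auto)

text \<open>Surjectivity comes from algebraicity: an algebraic \<open>y\<close> lies in the finite
  root set of a rational polynomial, and an injective self-map of that set is onto.\<close>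

lemma Gal_bij: "bij \<sigma>"
proof -
  have "y \<in> range \<sigma>" for y
  proof (cases "algebraic y")
    case True
    then obtain p where "\<And>i. coeff p i \<in> \<rat>" "p \<noteq> 0" "poly p y = 0"
      unfolding algebraic_altdef by blast
    then show ?thesis using Gal_permutes_roots[of p] by blast
  next
    case False
    then show ?thesis using Gal_not_algebraic by (metis rangeI)
  qed
  then show ?thesis using Gal_inj by (auto simp: bij_def)
qed

lemma Gal_algebraic_iff: "algebraic (\<sigma> x) \<longleftrightarrow> algebraic x"
  by (metis Gal_algebraic Gal_not_algebraic)

end

section \<open>Group structure of the automorphisms\<close>

lemma GalI:
  assumes "\<And>x. \<not> algebraic x \<Longrightarrow> \<sigma> x = x" "\<And>q. q \<in> \<rat> \<Longrightarrow> \<sigma> q = q"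
    "\<And>x y. algebraic x \<Longrightarrow> algebraic y \<Longrightarrow> \<sigma> (x + y) = \<sigma> x + \<sigma> y"
    "\<And>x y. algebraic x \<Longrightarrow> algebraic y \<Longrightarrow> \<sigma> (x * y) = \<sigma> x * \<sigma> y"
  shows "\<sigma> \<in> Gal"
  unfolding Gal_def embedding_def
  using assms assms(2)[of 0] by (auto simp: algebraic_add algebraic_mult intro: rat_imp_algebraic)

lemma Gal_id: "id \<in> Gal"
  by (rule GalI) auto

lemma Gal_comp: "\<sigma> \<in> Gal \<Longrightarrow> \<tau> \<in> Gal \<Longrightarrow> \<sigma> \<circ> \<tau> \<in> Gal"
  by (rule GalI) (simp_all add: Gal_not_algebraic Gal_Rats Gal_add Gal_mult Gal_algebraic)

lemma Gal_inv:
  assumes "\<sigma> \<in> Gal"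
  shows "inv_into UNIV \<sigma> \<in> Gal"
proof -
  have eqI: "inv_into UNIV \<sigma> y = x" if "\<sigma> x = y" for x y
    using that Gal_inj[OF assms] by (metis inv_f_f)
  have \<sigma>_inv: "\<sigma> (inv_into UNIV \<sigma> x) = x" for x
    using Gal_bij[OF assms] by (simp add: bij_is_surj surj_f_inv_f)
  have alg: "algebraic (inv_into UNIV \<sigma> x) \<longleftrightarrow> algebraic x" for x
    using Gal_algebraic_iff[OF assms] \<sigma>_inv by metis
  show ?thesis
    by (rule GalI; rule eqI)
      (simp_all add: assms Gal_not_algebraic Gal_Rats Gal_add Gal_mult alg \<sigma>_inv)
qed

section \<open>Fixed fields\<close>

lemma is_subfield_Rats_subset:
  assumes "is_subfield F"
  shows "\<rat> \<subseteq> F"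
proof
  have nat: "of_nat n \<in> F" for n
    by (induction n) (use assms in \<open>auto simp: is_subfield_def\<close>)
  have int: "of_int k \<in> F" for k
  proof (cases k rule: int_cases2)
    case (nonpos n)
    have "0 - of_nat n \<in> F" using assms nat unfolding is_subfield_def by blast
    then show ?thesis by (simp add: nonpos)
  qed (use nat in simp)
  fix q :: complex assume "q \<in> \<rat>"
  then obtain a b where "q = of_int a / of_int b" by (auto elim: Rats_cases')
  then show "q \<in> F"
    using assms int unfolding is_subfield_def by (auto simp: divide_inverse)
qed

text \<open>The minimal polynomial of \<open>z\<close> over \<open>F\<close> has degree at least 2,
  since otherwise its constant term would put \<open>z\<close> into \<open>F\<close>. Having a
  simple root at \<open>z\<close>, it has a second root \<open>w\<close>, and the identity on
  \<open>F\<close> extends to an automorphism sending \<open>z\<close> to \<open>w\<close>.\<close>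

lemma Gal_moves_outside_subfield:
  assumes F: "is_subfield F" "\<And>x. x \<in> F \<Longrightarrow> algebraic x" and z: "algebraic z" "z \<notin> F"
  obtains \<sigma> where "\<sigma> \<in> Gal" "\<And>x. x \<in> F \<Longrightarrow> \<sigma> x = x" "\<sigma> z \<noteq> z"
proof -
  \<comment> \<open>The inclusion of \<open>F\<close> as an embedding; related polynomials are then
    equal and have coefficients in \<open>F\<close>.\<close>
  have r: "embedding (Id_on F)"
    unfolding embedding_def using F is_subfield_Rats_subset[OF F(1)]
    by (auto simp: is_subfield_def)
  obtain p q where m: "minimal_rel (Id_on F) z p q" using minimal_rel_exists[OF r z(1)] .
  then have "(coeff p i, coeff q i) \<in> Id_on F" for i
    unfolding minimal_rel_def poly_rel_def by blast
  then have pF: "coeff p i \<in> F" and pq: "coeff p i = coeff q i" for i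
    by (metis Id_on_iff)+
  from pq have q: "q = p" by (simp add: poly_eq_iff)
  have p: "lead_coeff p = 1" "poly p z = 0" "degree p > 0"
    using m minimal_rel_degree[OF r m] by (auto simp: minimal_rel_def)
  obtain s where s: "p = [:- z, 1:] * s" using p(2) by (metis dvdE poly_eq_0_iff_dvd)
  have "degree s > 0"
  proof (rule ccontr)
    assume "\<not> degree s > 0"
    then obtain c where "s = [:c:]" by (auto elim: degree_eq_zeroE)
    moreover from this have "c = 1" using p(1,3) s by (auto split: if_splits)
    ultimately have "0 - coeff p 0 = z" by (simp add: s)
    with F(1) pF[of 0] z(2) show False unfolding is_subfield_def by metis
  qed
  then obtain w where w: "poly s w = 0" using alg_closed_imp_poly_has_root by blast
  \<comment> \<open>Separability in characteristic 0: at a double root the non-zero derivative, of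
    smaller degree and still over \<open>F\<close>, would vanish and contradict minimality.\<close>
  have "w \<noteq> z"
  proof
    assume "w = z"
    then have "poly (pderiv p) z = 0" using w by (simp add: s pderiv_mult del: mult_pCons_left)
    moreover have "pderiv p \<noteq> 0" using p(3) by (simp add: pderiv_eq_0_iff)
    moreover have "of_nat n \<in> F" for n
      using is_subfield_Rats_subset[OF F(1)] by auto
    then have "poly_rel (Id_on F) (pderiv p) (pderiv p)"
      using pF F(1) by (auto simp: poly_rel_def coeff_pderiv is_subfield_def simp del: of_nat_Suc)
    ultimately have "degree p \<le> degree (pderiv p)" using m unfolding minimal_rel_def by blast
    then show False using p(3) by (simp add: degree_pderiv)
  qed
  have "poly q w = 0" using w by (simp add: q s)
  then obtain t where t: "embedding t" "Id_on F \<subseteq> t" "(z, w) \<in> t"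
    using embedding_adjoin[OF r m z(1)] by blast
  obtain \<sigma> where "\<sigma> \<in> Gal" "\<And>x y. (x, y) \<in> t \<Longrightarrow> \<sigma> x = y"
    using Gal_extends_embedding[OF t(1)] by blast
  with t \<open>w \<noteq> z\<close> show ?thesis by (intro that[of \<sigma>]) auto
qed

section \<open>Minimal polynomials and Mahler measure\<close>

text \<open>Take the primitive part of a polynomial of least degree vanishing at \<open>x\<close>.
  Pseudo-division leaves remainder 0 by minimality, and Gauss's lemma removes the integer multiplier
  by passing to primitive parts. In a factorisation one factor vanishes at \<open>x\<close>, so the
  other is constant, and a unit because the content is 1.\<close>

lemma primitive_minimal_int_poly_exists:
  assumes "algebraic (x :: complex)"
  obtains p where "irreducible p" "content p = 1" "poly (map_poly of_int p) x = 0"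
    "\<And>q. poly (map_poly of_int q) x = 0 \<Longrightarrow> p dvd q"
proof -
  let ?P = "\<lambda>p. p \<noteq> 0 \<and> poly (map_poly of_int p) x = 0"
  obtain p0 where "?P p0" using assms by (rule algebraicE') blast
  then obtain m where m: "?P m" and min: "\<And>q. ?P q \<Longrightarrow> degree m \<le> degree q"
    using ex_has_least_nat[of ?P p0 degree] by blast
  define p where "p = primitive_part m"
  have "m = [:content m:] * p" by (simp add: p_def)
  then have "of_int (content m) * poly (map_poly of_int p) x = 0"
    using m by (metis of_int_poly_hom.hom_mult poly_mult of_int_hom.map_poly_pCons_hom
        map_poly_0 poly_const_conv)
  then have root: "poly (map_poly of_int p) x = 0" using m by simp
  have nz: "p \<noteq> 0" and cont: "content p = 1" using m by (simp_all add: p_def)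
  have min: "degree p \<le> degree q" if "?P q" for q
    using min[OF that] by (simp add: p_def)
  have dvd: "p dvd q" if q: "poly (map_poly of_int q) x = 0" for q
  proof -
    obtain a s where a: "a \<noteq> 0" "Polynomial.smult a q = p * s + pseudo_mod q p"
      using pseudo_mod(1)[OF nz] by blast
    have "poly (map_poly of_int (Polynomial.smult a q)) x = 0"
      using q by (simp add: of_int_hom.map_poly_hom_smult)
    then have "poly (map_poly of_int (pseudo_mod q p)) x = 0"
      unfolding a(2) using root by (simp add: of_int_poly_hom.hom_mult of_int_poly_hom.hom_add)
    then have "pseudo_mod q p = 0"
      using pseudo_mod(2)[OF nz, of q] min[of "pseudo_mod q p"] by linarith
    then have "p dvd Polynomial.smult a q" using a(2) by simp
    then have "primitive_part p dvd primitive_part (Polynomial.smult a q)" ..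
    then have "p dvd primitive_part q"
      using a(1) cont
      by (cases "a > 0") (simp_all add: primitive_part_smult primitive_part_prim sgn_if)
    then have "p dvd [:content q:] * primitive_part q" by (rule dvd_mult)
    then show ?thesis by simp
  qed
  have "irreducible p"
  proof (rule irreducibleI)
    show "\<not> is_unit p"
    proof
      assume "is_unit p"
      then obtain c where "p = [:c:]" by (auto simp: is_unit_poly_iff)
      with root nz show False by simp
    qed
  next
    fix u v assume uv: "p = u * v"
    have unit: "is_unit t" if st: "p = s * t" "poly (map_poly of_int s) x = 0" for s t
    proof -
      have "s \<noteq> 0" "t \<noteq> 0" using st nz by auto
      then have "degree t = 0" using min[of s] st by (simp add: degree_mult_eq)
      then obtain c where c: "t = [:c:]" by (rule degree_eq_zeroE)
      then have "c dvd content p" using st by (simp flip: const_poly_dvd_iff_dvd_content)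
      then show ?thesis using cont c by (simp add: is_unit_const_poly_iff)
    qed
    have "poly (map_poly of_int u) x = 0 \<or> poly (map_poly of_int v) x = 0"
      using root by (simp add: uv of_int_poly_hom.hom_mult)
    then show "is_unit u \<or> is_unit v"
      using unit[of u v] unit[of v u] uv by (auto simp: mult.commute)
  qed (use nz in auto)
  then show ?thesis using cont root dvd by (rule that)
qed

lemma irreducible_int_poly_dvd_if_common_root:
  assumes p: "irreducible p" "poly (map_poly of_int p) (x :: complex) = 0"
    and q: "poly (map_poly of_int q) x = 0"
  shows "p dvd q"
proof -
  have "p \<noteq> 0" using p(1) by auto
  then have "algebraic x"
    using p(2) by (intro algebraicI[of "map_poly of_int p"]) auto
  then obtain m where m: "irreducible m" "\<And>q. poly (map_poly of_int q) x = 0 \<Longrightarrow> m dvd q"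
    by (rule primitive_minimal_int_poly_exists) blast
  have "p dvd m"
    using irreducibleD'[OF p(1) m(2)[OF p(2)]] m(1) by (auto simp: irreducible_def)
  with m(2)[OF q] show ?thesis by (rule dvd_trans[rotated])
qed

lemma min_int_poly:
  assumes "algebraic x"
  shows "irreducible (min_int_poly x)" "lead_coeff (min_int_poly x) > 0"
    "poly (map_poly of_int (min_int_poly x)) x = 0"
proof -
  let ?P = "\<lambda>p. irreducible p \<and> content p = 1 \<and> lead_coeff p > 0 \<and>
    poly (map_poly of_int p) x = 0"
  obtain m where m: "irreducible m" "content m = 1" "poly (map_poly of_int m) x = 0"
    using assms by (rule primitive_minimal_int_poly_exists)
  define p where "p = (if lead_coeff m > 0 then m else - m)"
  have "m \<noteq> 0" using m by auto
  moreover have "irreducible (- m)"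
    using irreducible_mult_unit_left[of "-1" m] m(1) by simp
  ultimately have p: "?P p"
    using m content_smult[of "-1" m] by (auto simp: p_def of_int_poly_hom.hom_uminus not_less le_less)
  have "?P (min_int_poly x)"
    unfolding min_int_poly_def
  proof (rule theI[of ?P, OF p])
    \<comment> \<open>Two candidates divide each other; positivity of the leading coefficients
      excludes a difference in sign.\<close>
    fix q assume q: "?P q"
    then have dvd: "p dvd q" "q dvd p"
      using p irreducible_int_poly_dvd_if_common_root by blast+
    have "lead_coeff p dvd lead_coeff q" "lead_coeff q dvd lead_coeff p"
      using dvd by (metis dvd_def lead_coeff_mult)+
    then have "lead_coeff p = lead_coeff q"
      using p q by (intro zdvd_antisym_nonneg) auto
    with dvd show "q = p" by (intro poly_dvd_antisym) auto
  qed
  then show "irreducible (min_int_poly x)" "lead_coeff (min_int_poly x) > 0"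
    "poly (map_poly of_int (min_int_poly x)) x = 0"
    by blast+
qed

section \<open>Mahler measure of complex polynomials\<close>

definition Mahler_poly :: "complex poly \<Rightarrow> real" where
  "Mahler_poly p = cmod (lead_coeff p) * (\<Prod>z\<in>#proots p. max 1 (cmod z))"

text \<open>Links the root multiset, for which multiplicativity is immediate, to the form with
  multiplicities in \<open>mahler\<close>.\<close>

lemma Mahler_poly_altdef:
  "p \<noteq> 0 \<Longrightarrow> Mahler_poly p =
     cmod (lead_coeff p) * (\<Prod>z\<in>{z. poly p z = 0}. max 1 (cmod z) ^ Polynomial.order z p)"
  by (simp add: Mahler_poly_def image_prod_mset_multiplicity)

lemma mahler_eq_Mahler_poly:
  assumes "algebraic x"
  shows "mahler x = Mahler_poly (map_poly of_int (min_int_poly x))"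
proof -
  have "min_int_poly x \<noteq> 0" "lead_coeff (min_int_poly x) > 0"
    using min_int_poly[OF assms] by auto
  then show ?thesis
    by (simp add: mahler_def Let_def Mahler_poly_altdef)
qed

lemma prod_mset_max_1_ge_1: "1 \<le> (\<Prod>z\<in>#M. max 1 (cmod z))"
proof (induction M)
  case (add z M)
  then show ?case using mult_mono[of 1 "max 1 (cmod z)" 1] by simp
qed simp

lemma Mahler_poly_mult:
  "p \<noteq> 0 \<Longrightarrow> q \<noteq> 0 \<Longrightarrow> Mahler_poly (p * q) = Mahler_poly p * Mahler_poly q"
  by (simp add: Mahler_poly_def lead_coeff_mult norm_mult proots_mult)

lemma Mahler_poly_prod:
  "finite I \<Longrightarrow> (\<And>i. i \<in> I \<Longrightarrow> f i \<noteq> 0) \<Longrightarrow> Mahler_poly (prod f I) = (\<Prod>i\<in>I. Mahler_poly (f i))"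
proof (induction I rule: finite_induct)
  case empty
  then show ?case by (simp add: Mahler_poly_def)
qed (simp add: Mahler_poly_mult)

lemma Mahler_poly_smult:
  "c \<noteq> 0 \<Longrightarrow> Mahler_poly (Polynomial.smult c p) = cmod c * Mahler_poly p"
  by (simp add: Mahler_poly_def norm_mult)

lemma Mahler_poly_int_ge_1:
  assumes "p \<noteq> 0"
  shows "1 \<le> Mahler_poly (map_poly of_int p)"
proof -
  have "1 \<le> \<bar>lead_coeff p\<bar>" using assms by (simp add: int_one_le_iff_zero_less)
  then have "1 \<le> cmod (lead_coeff (map_poly of_int p :: complex poly))"
    by simp
  then show ?thesis
    unfolding Mahler_poly_def using mult_mono[of 1 _ 1, OF _ prod_mset_max_1_ge_1] by fastforce
qed

lemma mahler_ge_1: "algebraic x \<Longrightarrow> 1 \<le> mahler x"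
  using min_int_poly(2)[of x] by (auto simp: mahler_eq_Mahler_poly intro!: Mahler_poly_int_ge_1)

text \<open>The minimal polynomial divides \<open>p\<close> over the integers, and the cofactor has
  measure at least 1. An upper bound for \<open>mahler\<close> thus needs only some integer
  polynomial with the given root.\<close>

lemma mahler_le_Mahler_poly:
  assumes "p \<noteq> 0" "poly (map_poly of_int p) x = 0"
  shows "mahler x \<le> Mahler_poly (map_poly of_int p)"
proof -
  have x: "algebraic x"
    using assms by (intro algebraicI[of "map_poly of_int p"]) auto
  obtain q where q: "p = min_int_poly x * q"
    using irreducible_int_poly_dvd_if_common_root[OF min_int_poly(1,3)[OF x] assms(2)] by (rule dvdE)
  with assms have nz: "min_int_poly x \<noteq> 0" "q \<noteq> 0" by auto
  have "mahler x * 1 \<le> mahler x * Mahler_poly (map_poly of_int q)"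
    using mahler_ge_1[OF x] nz by (intro mult_left_mono Mahler_poly_int_ge_1) auto
  also have "\<dots> = Mahler_poly (map_poly of_int p)"
    using nz by (simp add: q mahler_eq_Mahler_poly[OF x] Mahler_poly_mult of_int_poly_hom.hom_mult)
  finally show ?thesis by simp
qed

text \<open>All d roots, counted with multiplicity, have the d-th root of |c| as modulus, so the
  measure is the d-th power of one factor \<open>t\<close>.\<close>

lemma Mahler_poly_binomial:
  assumes "d > 0"
  shows "Mahler_poly (monom 1 d - [:c:]) = max 1 (cmod c)"
proof -
  let ?p = "monom 1 d - [:c:]"
  have deg: "degree ?p = d"
    using assms by (intro antisym degree_le le_degree) (auto simp: coeff_pCons split: nat.splits)
  have lead: "lead_coeff ?p = 1"
    using assms unfolding deg by (auto simp: coeff_pCons split: nat.splits)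
  define t where "t = max 1 (root d (cmod c))"
  have "max 1 (cmod z) = t" if "z \<in># proots ?p" for z
  proof -
    have "?p \<noteq> 0" using lead by (metis coeff_0 zero_neq_one)
    then have "z ^ d = c" using that by (simp add: poly_monom)
    then have "cmod c = cmod z ^ d" by (metis norm_power)
    then show ?thesis using assms by (simp add: t_def real_root_power_cancel)
  qed
  then have "image_mset (\<lambda>z. max 1 (cmod z)) (proots ?p) = image_mset (\<lambda>_. t) (proots ?p)"
    by (rule image_mset_cong)
  then have "Mahler_poly ?p = t ^ d"
    unfolding Mahler_poly_def lead using size_proots_complex[of ?p] deg
    by (simp add: image_mset_const_eq)
  also have "\<dots> = max 1 (cmod c)"
  proof (cases "cmod c \<le> 1")
    case True
    then have "root d (cmod c) \<le> 1" using assms by simp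
    then show ?thesis using True by (simp add: t_def max_def)
  next
    case False
    then have "root d (cmod c) \<ge> 1" using assms by simp
    then have "t = root d (cmod c)" by (simp add: t_def max_def)
    then show ?thesis using False assms by (simp add: max_def)
  qed
  finally show ?thesis .
qed

section \<open>Orbits and normalised norms\<close>

definition Gal_over :: "complex set \<Rightarrow> (complex \<Rightarrow> complex) set" where
  "Gal_over K = {\<sigma> \<in> Gal. \<forall>x\<in>K. \<sigma> x = x}"

lemma Gal_overD: "\<sigma> \<in> Gal_over K \<Longrightarrow> \<sigma> \<in> Gal" "\<sigma> \<in> Gal_over K \<Longrightarrow> x \<in> K \<Longrightarrow> \<sigma> x = x"
  by (auto simp: Gal_over_def)

lemma Gal_over_id: "id \<in> Gal_over K"
  by (simp add: Gal_over_def Gal_id)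

lemma Gal_over_comp: "\<sigma> \<in> Gal_over K \<Longrightarrow> \<tau> \<in> Gal_over K \<Longrightarrow> \<sigma> \<circ> \<tau> \<in> Gal_over K"
  by (simp add: Gal_over_def Gal_comp)

lemma Gal_inv_cancel:
  assumes "\<sigma> \<in> Gal"
  shows "inv_into UNIV \<sigma> (\<sigma> x) = x" "\<sigma> (inv_into UNIV \<sigma> x) = x"
  by (rule inv_f_f[OF Gal_inj[OF assms]], rule surj_f_inv_f[OF bij_is_surj[OF Gal_bij[OF assms]]])

lemma Gal_over_inv:
  assumes "\<sigma> \<in> Gal_over K"
  shows "inv_into UNIV \<sigma> \<in> Gal_over K"
proof -
  have "inv_into UNIV \<sigma> x = x" if "x \<in> K" for x
    using Gal_inv_cancel(1)[OF Gal_overD(1)[OF assms], of x] Gal_overD(2)[OF assms that] by simp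
  then show ?thesis using Gal_inv[OF Gal_overD(1)[OF assms]] by (simp add: Gal_over_def)
qed

lemma Gal_over_empty: "Gal_over {} = Gal"
  by (auto simp: Gal_over_def)

text \<open>For algebraic \<open>z\<close> and a field \<open>K\<close> of algebraic numbers these
  are the conjugates of \<open>z\<close> over \<open>K\<close>; the empty set in place of
  \<open>K\<close> gives the conjugates over the rationals.\<close>

definition orb :: "complex set \<Rightarrow> complex \<Rightarrow> complex set" where
  "orb K z = (\<lambda>\<sigma>. \<sigma> z) ` Gal_over K"

lemma orb_self: "z \<in> orb K z"
  unfolding orb_def using Gal_over_id by (metis id_apply image_eqI)

lemma orb_subset:
  assumes "w \<in> orb K z"
  shows "orb K w \<subseteq> orb K z"
proof
  fix v assume "v \<in> orb K w"
  then obtain \<sigma> \<tau> where *: "\<sigma> \<in> Gal_over K" "\<tau> \<in> Gal_over K" "v = (\<sigma> \<circ> \<tau>) z"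
    using assms by (auto simp: orb_def)
  then show "v \<in> orb K z" using Gal_over_comp[OF *(1,2)] unfolding orb_def by blast
qed

lemma orb_eq:
  assumes "w \<in> orb K z"
  shows "orb K w = orb K z"
proof
  obtain \<sigma> where \<sigma>: "\<sigma> \<in> Gal_over K" "w = \<sigma> z" using assms by (auto simp: orb_def)
  then have "z = inv_into UNIV \<sigma> w" using Gal_inv_cancel(1)[OF Gal_overD(1)] by simp
  then have "z \<in> orb K w" using Gal_over_inv[OF \<sigma>(1)] by (auto simp: orb_def)
  then show "orb K z \<subseteq> orb K w" by (rule orb_subset)
qed (rule orb_subset[OF assms])

lemma orb_subset_roots:
  assumes "\<And>i. coeff p i \<in> \<rat>" "poly p z = 0"
  shows "orb K z \<subseteq> {w. poly p w = 0}"
  using Gal_root[OF Gal_overD(1) assms] by (auto simp: orb_def)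

lemma orb_finite:
  assumes "algebraic z"
  shows "finite (orb K z)"
proof -
  obtain p where p: "\<And>i. coeff p i \<in> \<rat>" "p \<noteq> 0" "poly p z = 0"
    using assms unfolding algebraic_altdef by blast
  show ?thesis
    by (rule finite_subset[OF orb_subset_roots[OF p(1,3)] poly_roots_finite[OF p(2)]])
qed

lemma orb_algebraic: "algebraic z \<Longrightarrow> w \<in> orb K z \<Longrightarrow> algebraic w"
  by (auto simp: orb_def intro: Gal_algebraic Gal_overD(1))

lemma orb_nonzero: "z \<noteq> 0 \<Longrightarrow> w \<in> orb K z \<Longrightarrow> w \<noteq> 0"
  using Gal_eq_0_iff[OF Gal_overD(1)] by (auto simp: orb_def)

lemma orb_fixed: "z \<in> K \<Longrightarrow> orb K z = {z}"
  using orb_self[of z K] by (auto simp: orb_def Gal_overD(2))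

lemma Gal_over_image_orb:
  assumes "\<sigma> \<in> Gal_over K"
  shows "\<sigma> ` orb K z = orb K z"
proof
  show sub: "\<sigma> ` orb K z \<subseteq> orb K z"
  proof safe
    fix w assume "w \<in> orb K z"
    then have "orb K w = orb K z" by (rule orb_eq)
    then show "\<sigma> w \<in> orb K z" using assms by (auto simp: orb_def)
  qed
  show "orb K z \<subseteq> \<sigma> ` orb K z"
  proof
    fix w assume w: "w \<in> orb K z"
    have "inv_into UNIV \<sigma> w \<in> orb K w" using Gal_over_inv[OF assms] by (auto simp: orb_def)
    then have "inv_into UNIV \<sigma> w \<in> orb K z" using orb_eq[OF w] by simp
    then show "w \<in> \<sigma> ` orb K z"
      using Gal_inv_cancel(2)[OF Gal_overD(1)[OF assms]] by (metis image_eqI)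
  qed
qed

lemma fixed_by_Gal_over:
  assumes "is_subfield K" "\<And>x. x \<in> K \<Longrightarrow> algebraic x" "algebraic z"
    and "\<And>\<sigma>. \<sigma> \<in> Gal_over K \<Longrightarrow> \<sigma> z = z"
  shows "z \<in> K"
proof (rule ccontr)
  assume "z \<notin> K"
  with assms obtain \<sigma> where "\<sigma> \<in> Gal" "\<And>x. x \<in> K \<Longrightarrow> \<sigma> x = x" "\<sigma> z \<noteq> z"
    using Gal_moves_outside_subfield by metis
  then show False using assms(4)[of \<sigma>] by (auto simp: Gal_over_def)
qed

text \<open>An automorphism over \<open>K\<close> only permutes the factors, so the product lies in
  the fixed field, which is \<open>K\<close>.\<close>

lemma prod_orb_in_subfield:
  assumes K: "is_subfield K" "\<And>x. x \<in> K \<Longrightarrow> algebraic x" and z: "algebraic z"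
  shows "\<Prod>(orb K z) \<in> K"
proof (rule fixed_by_Gal_over[OF K])
  show "algebraic (\<Prod>(orb K z))" using orb_algebraic[OF z] by (rule algebraic_prod)
  fix \<sigma> assume \<sigma>: "\<sigma> \<in> Gal_over K"
  have inj: "inj_on \<sigma> (orb K z)" using Gal_inj[OF Gal_overD(1)[OF \<sigma>]] by (rule inj_on_subset) simp
  have "\<sigma> (\<Prod>(orb K z)) = (\<Prod>x\<in>orb K z. \<sigma> x)"
    using orb_algebraic[OF z] by (rule Gal_prod[OF Gal_overD(1)[OF \<sigma>]])
  also have "\<dots> = \<Prod>(\<sigma> ` orb K z)" using inj by (simp add: prod.reindex)
  finally show "\<sigma> (\<Prod>(orb K z)) = \<Prod>(orb K z)" by (simp add: Gal_over_image_orb[OF \<sigma>])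
qed

text \<open>\<open>b\<close> represents the norm of \<open>z\<close> over \<open>K\<close>, normalised by the degree of \<open>z\<close> over \<open>K\<close>.\<close>
definition orb_mean :: "complex set \<Rightarrow> complex \<Rightarrow> complex \<Rightarrow> bool" where
  "orb_mean K z b \<longleftrightarrow> b ^ card (orb K z) = \<Prod>(orb K z)"

lemma card_orb_pos: "algebraic z \<Longrightarrow> card (orb K z) > 0"
  using orb_finite[of z K] orb_self[of z K] by (auto simp: card_gt_0_iff)

lemma orb_mean_exists:
  assumes "algebraic z"
  obtains b where "orb_mean K z b"
  using nth_root_exists[OF card_orb_pos[OF assms], of K "\<Prod>(orb K z)"] that
  unfolding orb_mean_def by blast

lemma algebraic_power_cancel:
  assumes "algebraic (x ^ n)" "n > 0"
  shows "algebraic (x :: complex)"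
proof (rule algebraic_root[OF assms(1)])
  show "poly (monom 1 n) x = x ^ n" by (simp add: poly_monom)
qed (use assms(2) in \<open>auto simp: degree_monom_eq\<close>)

lemma orb_mean_alg_nz:
  assumes "alg_nz z" "orb_mean K z b"
  shows "alg_nz b"
proof -
  have z: "algebraic z" "z \<noteq> 0" using assms(1) by (auto simp: alg_nz_def)
  have "\<Prod>(orb K z) \<noteq> 0"
    using orb_finite[OF z(1)] orb_nonzero[OF z(2)] by (auto simp: prod_zero_iff)
  then have "b \<noteq> 0"
    using assms(2) card_orb_pos[OF z(1), of K] by (auto simp: orb_mean_def zero_power)
  moreover have "algebraic b"
  proof (rule algebraic_power_cancel[OF _ card_orb_pos[OF z(1)]])
    show "algebraic (b ^ card (orb K z))"
      using assms(2) orb_algebraic[OF z(1)] by (auto simp: orb_mean_def intro: algebraic_prod)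
  qed
  ultimately show ?thesis by (simp add: alg_nz_def)
qed

text \<open>A finite set of automorphisms that averages over all orbits of \<open>C\<close> at once: one
  representative for each restriction to \<open>C\<close>. All fibres of the evaluation at \<open>c\<close> have the same
  cardinality because the group permutes them transitively.\<close>
lemma averaging_automorphisms:
  assumes C: "finite C" "\<And>c. c \<in> C \<Longrightarrow> algebraic c"
  obtains \<Sigma> where "finite \<Sigma>" "\<Sigma> \<noteq> {}" "\<Sigma> \<subseteq> Gal_over K"
    "\<And>c b. c \<in> C \<Longrightarrow> orb_mean K c b \<Longrightarrow> (\<Prod>\<sigma>\<in>\<Sigma>. \<sigma> c) = b ^ card \<Sigma>"
proof -
  define R where "R = (\<lambda>\<sigma>. restrict \<sigma> C :: complex \<Rightarrow> complex)"
  define T where "T = R ` Gal_over K"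
  \<comment> \<open>There are finitely many restrictions, because each of them sends every element
    of the finite set \<open>C\<close> into its finite orbit.\<close>
  have "T \<subseteq> (\<Pi>\<^sub>E c\<in>C. orb K c)"
    by (auto simp: T_def R_def orb_def)
  then have finT: "finite T"
    by (rule finite_subset) (use C orb_finite in \<open>auto intro!: finite_PiE\<close>)
  define \<Sigma> where "\<Sigma> = inv_into (Gal_over K) R ` T"
  have inj: "inj_on (inv_into (Gal_over K) R) T"
    unfolding T_def by (rule inj_on_inv_into) simp
  have R_inv: "R (inv_into (Gal_over K) R t) = t" if "t \<in> T" for t
    using that unfolding T_def by (rule f_inv_into_f)
  have card: "card \<Sigma> = card T" unfolding \<Sigma>_def using inj by (rule card_image)
  have act: "R (\<tau> \<circ> t) \<in> T" if \<tau>t: "\<tau> \<in> Gal_over K" "t \<in> T" for \<tau> t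
  proof -
    obtain \<sigma> where \<sigma>: "\<sigma> \<in> Gal_over K" "t = R \<sigma>" using \<tau>t(2) by (auto simp: T_def)
    have "R (\<tau> \<circ> t) = R (\<tau> \<circ> \<sigma>)" by (auto simp: \<sigma> R_def)
    then show ?thesis using Gal_over_comp[OF \<tau>t(1) \<sigma>(1)] by (simp add: T_def)
  qed
  have R_T: "R t = t" if "t \<in> T" for t
    using that by (auto simp: T_def R_def)
  have prod_T: "(\<Prod>t\<in>T. t c) = b ^ card T" if c: "c \<in> C" and b: "orb_mean K c b" for c b
  proof -
    define F where "F w = {t \<in> T. t c = w}" for w
    have img: "(\<lambda>t. t c) ` T = orb K c"
      using c by (auto simp: T_def R_def orb_def image_image)
    have finO: "finite (orb K c)" using C c orb_finite by auto
    have cardF: "card (F w) = card (F c)" if w: "w \<in> orb K c" for w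
    proof -
      obtain \<tau> where \<tau>: "\<tau> \<in> Gal_over K" "w = \<tau> c" using w by (auto simp: orb_def)
      note \<tau>' = Gal_over_inv[OF \<tau>(1)]
      note cancel = Gal_inv_cancel[OF Gal_overD(1)[OF \<tau>(1)]]
      \<comment> \<open>Composition with \<open>\<tau>\<close>, undone by composition with its
        inverse, matches the fibre over \<open>c\<close> with the fibre over
        \<open>w\<close>.\<close>
      have "bij_betw (\<lambda>t. R (\<tau> \<circ> t)) (F c) (F w)"
      proof (rule bij_betw_byWitness[where f' = "\<lambda>t. R (inv_into UNIV \<tau> \<circ> t)"])
        have "R (inv_into UNIV \<tau> \<circ> R (\<tau> \<circ> t)) = R t" for t
          by (auto simp: R_def cancel)
        then show "\<forall>t\<in>F c. R (inv_into UNIV \<tau> \<circ> R (\<tau> \<circ> t)) = t" by (auto simp: F_def R_T)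
        have "R (\<tau> \<circ> R (inv_into UNIV \<tau> \<circ> t)) = R t" for t
          by (auto simp: R_def cancel)
        then show "\<forall>t\<in>F w. R (\<tau> \<circ> R (inv_into UNIV \<tau> \<circ> t)) = t" by (auto simp: F_def R_T)
        show "(\<lambda>t. R (\<tau> \<circ> t)) ` F c \<subseteq> F w"
          using act[OF \<tau>(1)] c by (auto simp: F_def) (simp add: R_def \<tau>(2))
        show "(\<lambda>t. R (inv_into UNIV \<tau> \<circ> t)) ` F w \<subseteq> F c"
          using act[OF \<tau>'] c by (auto simp: F_def) (simp add: R_def \<tau>(2), metis cancel(1))
      qed
      then show ?thesis by (simp add: bij_betw_same_card)
    qed
    have "(\<Prod>t\<in>T. t c) = (\<Prod>w\<in>orb K c. \<Prod>t\<in>F w. t c)"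
      unfolding F_def by (rule prod.group[symmetric, OF finT finO]) (simp add: img)
    also have "\<dots> = (\<Prod>w\<in>orb K c. w ^ card (F c))"
    proof (rule prod.cong[OF refl])
      fix w assume "w \<in> orb K c"
      have "(\<Prod>t\<in>F w. t c) = (\<Prod>t\<in>F w. w)" by (rule prod.cong) (auto simp: F_def)
      then show "(\<Prod>t\<in>F w. t c) = w ^ card (F c)" using cardF[OF \<open>w \<in> orb K c\<close>] by simp
    qed
    also have "\<dots> = \<Prod>(orb K c) ^ card (F c)" by (simp add: prod_power_distrib)
    also have "\<dots> = b ^ (card (orb K c) * card (F c))"
      using b by (simp add: orb_mean_def power_mult)
    also have "card T = (\<Sum>w\<in>orb K c. \<Sum>t\<in>F w. 1)"
      unfolding F_def by (subst sum.group[OF finT finO]) (simp_all add: img)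
    then have "card (orb K c) * card (F c) = card T" using cardF by simp
    finally show ?thesis .
  qed
  show ?thesis
  proof (rule that)
    show "finite \<Sigma>" using finT by (simp add: \<Sigma>_def)
    show "\<Sigma> \<noteq> {}" using Gal_over_id[of K] by (auto simp: \<Sigma>_def T_def)
    show "\<Sigma> \<subseteq> Gal_over K" unfolding \<Sigma>_def T_def by (auto intro: inv_into_into)
    fix c b assume c: "c \<in> C" "orb_mean K c b"
    have "(\<Prod>\<sigma>\<in>\<Sigma>. \<sigma> c) = (\<Prod>t\<in>T. inv_into (Gal_over K) R t c)"
      unfolding \<Sigma>_def using inj by (simp add: prod.reindex)
    also have "\<dots> = (\<Prod>t\<in>T. t c)"
      by (rule prod.cong[OF refl]) (use R_inv c in \<open>metis R_def restrict_apply'\<close>)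
    finally show "(\<Prod>\<sigma>\<in>\<Sigma>. \<sigma> c) = b ^ card \<Sigma>" using prod_T[OF c] card by simp
  qed
qed

section \<open>Roots of unity and the normalised norm modulo torsion\<close>

lemma root_of_unity_mult:
  assumes "root_of_unity x" "root_of_unity y"
  shows "root_of_unity (x * y)"
proof -
  obtain m n where "m > 0" "x ^ m = 1" "n > 0" "y ^ n = 1"
    using assms by (auto simp: root_of_unity_def)
  then have "m * n > 0" "(x * y) ^ (m * n) = 1"
    by (simp_all add: power_mult_distrib power_mult) (simp add: power_mult[symmetric] mult.commute[of m] power_mult)
  then show ?thesis unfolding root_of_unity_def by blast
qed

lemma root_of_unity_prod:
  "(\<And>i. i \<in> I \<Longrightarrow> root_of_unity (f i)) \<Longrightarrow> root_of_unity (prod f I)"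
proof (induction I rule: infinite_finite_induct)
  case (insert x F)
  then show ?case by (simp add: root_of_unity_mult)
qed (auto simp: root_of_unity_def)

lemma root_of_unity_power_cancel:
  assumes "root_of_unity (x ^ n)" "n > 0"
  shows "root_of_unity x"
proof -
  obtain m where "m > 0" "x ^ (n * m) = 1"
    using assms by (auto simp: root_of_unity_def power_mult)
  then show ?thesis using assms(2) unfolding root_of_unity_def by (metis nat_0_less_mult_iff)
qed

lemma root_of_unity_Gal:
  assumes "\<sigma> \<in> Gal" "root_of_unity x"
  shows "root_of_unity (\<sigma> x)"
proof -
  obtain n where n: "n > 0" "x ^ n = 1" using assms by (auto simp: root_of_unity_def)
  then have "algebraic x" by (intro algebraic_power_cancel[of x n]) auto
  then have "\<sigma> x ^ n = 1" using Gal_power[OF assms(1), of x n] n Gal_Rats[OF assms(1), of 1] by simp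
  with n show ?thesis by (auto simp: root_of_unity_def)
qed

text \<open>Averaging \<open>x\<close> and all \<open>a i\<close> over one common set
  \<open>\<Sigma>\<close> makes the normalised norms multiplicative: the
  \<open>card \<Sigma>\<close>-th power of the quotient in question is a product of conjugates of a
  root of unity. A single index gives independence of the representative; the full product gives the
  factorisation.\<close>

lemma same_class_orb_mean:
  assumes I: "finite I" "\<And>i. i \<in> I \<Longrightarrow> alg_nz (a i)" "\<And>i. i \<in> I \<Longrightarrow> orb_mean K (a i) (b i)"
    and x: "alg_nz x" "orb_mean K x y"
    and same: "same_class x (\<Prod>i\<in>I. a i)"
  shows "same_class y (\<Prod>i\<in>I. b i)"
proof -
  have alg: "algebraic x" "\<And>i. i \<in> I \<Longrightarrow> algebraic (a i)"
    using I(2) x(1) by (auto simp: alg_nz_def)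
  obtain \<Sigma> where \<Sigma>: "finite \<Sigma>" "\<Sigma> \<noteq> {}" "\<Sigma> \<subseteq> Gal_over K"
    and avg: "\<And>c d. c \<in> insert x (a ` I) \<Longrightarrow> orb_mean K c d \<Longrightarrow> (\<Prod>\<sigma>\<in>\<Sigma>. \<sigma> c) = d ^ card \<Sigma>"
    using averaging_automorphisms[of "insert x (a ` I)" K] I(1) alg by auto
  have Gal: "\<sigma> \<in> Gal" if "\<sigma> \<in> \<Sigma>" for \<sigma> using \<Sigma>(3) that Gal_overD(1) by blast
  have "(\<Prod>i\<in>I. b i) ^ card \<Sigma> = (\<Prod>i\<in>I. \<Prod>\<sigma>\<in>\<Sigma>. \<sigma> (a i))"
    unfolding prod_power_distrib 
    by (rule prod.cong[OF refl], rule avg[symmetric]) (auto intro: I(3))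
  also have "\<dots> = (\<Prod>\<sigma>\<in>\<Sigma>. \<Prod>i\<in>I. \<sigma> (a i))" by (rule prod.swap)
  also have "\<dots> = (\<Prod>\<sigma>\<in>\<Sigma>. \<sigma> (\<Prod>i\<in>I. a i))"
    using alg(2) by (simp add: Gal_prod[OF Gal])
  finally have b: "(\<Prod>i\<in>I. b i) ^ card \<Sigma> = (\<Prod>\<sigma>\<in>\<Sigma>. \<sigma> (\<Prod>i\<in>I. a i))" .
  have "(y / (\<Prod>i\<in>I. b i)) ^ card \<Sigma> = (\<Prod>\<sigma>\<in>\<Sigma>. \<sigma> x / \<sigma> (\<Prod>i\<in>I. a i))"
    using avg[OF _ x(2)] by (simp add: power_divide b prod_dividef)
  also have "\<dots> = (\<Prod>\<sigma>\<in>\<Sigma>. \<sigma> (x / (\<Prod>i\<in>I. a i)))"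
    using alg algebraic_prod[of I a]
    by (simp add: divide_inverse Gal_mult[OF Gal] Gal_inverse[OF Gal] algebraic_inverse)
  also have "root_of_unity \<dots>"
  proof (rule root_of_unity_prod)
    fix \<sigma> assume "\<sigma> \<in> \<Sigma>"
    from root_of_unity_Gal[OF Gal[OF this]] same
    show "root_of_unity (\<sigma> (x / (\<Prod>i\<in>I. a i)))" unfolding same_class_def .
  qed
  finally show ?thesis
    unfolding same_class_def by (rule root_of_unity_power_cancel) (use \<Sigma> in \<open>simp add: card_gt_0_iff\<close>)
qed

section \<open>Mahler measure of a normalised norm\<close>

text \<open>Stability of \<open>K\<close> makes \<open>Gal_over K\<close> a normal subgroup:
  conjugating by \<open>\<rho>\<close> keeps \<open>\<tau>\<close> trivial on \<open>K\<close>. The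
  reverse inclusion is the same argument for the inverse automorphism.\<close>

lemma Gal_image_orb:
  assumes normal: "\<And>\<sigma>. \<sigma> \<in> Gal \<Longrightarrow> \<sigma> ` K \<subseteq> K" and \<sigma>: "\<sigma> \<in> Gal"
  shows "\<sigma> ` orb K z = orb K (\<sigma> z)"
proof -
  have sub: "\<rho> ` orb K y \<subseteq> orb K (\<rho> y)" if \<rho>: "\<rho> \<in> Gal" for \<rho> y
  proof safe
    fix w assume "w \<in> orb K y"
    then obtain \<tau> where \<tau>: "\<tau> \<in> Gal_over K" "w = \<tau> y" by (auto simp: orb_def)
    note cancel = Gal_inv_cancel[OF \<rho>]
    define \<tau>' where "\<tau>' = \<rho> \<circ> \<tau> \<circ> inv_into UNIV \<rho>"
    have "\<tau>' \<in> Gal"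
      unfolding \<tau>'_def by (intro Gal_comp Gal_inv \<rho> Gal_overD(1)[OF \<tau>(1)])
    moreover have "\<tau>' x = x" if "x \<in> K" for x
    proof -
      have "inv_into UNIV \<rho> x \<in> K" using normal[OF Gal_inv[OF \<rho>]] that by blast
      then show ?thesis by (simp add: \<tau>'_def Gal_overD(2)[OF \<tau>(1)] cancel)
    qed
    ultimately have "\<tau>' \<in> Gal_over K" by (simp add: Gal_over_def)
    moreover have "\<rho> w = \<tau>' (\<rho> y)" by (simp add: \<tau>'_def \<tau>(2) cancel)
    ultimately show "\<rho> w \<in> orb K (\<rho> y)" by (auto simp: orb_def)
  qed
  note cancel = Gal_inv_cancel[OF \<sigma>]
  have "orb K (\<sigma> z) \<subseteq> \<sigma> ` orb K z"
  proof
    fix w assume "w \<in> orb K (\<sigma> z)"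
    then have "inv_into UNIV \<sigma> w \<in> orb K z"
      using sub[OF Gal_inv[OF \<sigma>], of "\<sigma> z"] by (auto simp: cancel)
    then show "w \<in> \<sigma> ` orb K z" using cancel(2)[of w] by (metis image_eqI)
  qed
  with sub[OF \<sigma>] show ?thesis by blast
qed

lemma prod_const_poly: "(\<Prod>i\<in>I. [:f i:]) = [:\<Prod>i\<in>I. f i:]"
  by (induction I rule: infinite_finite_induct) (simp_all add: one_pCons mult.commute)

lemma is_subfield_Rats: "is_subfield \<rat>"
  by (simp add: is_subfield_def)

lemma mahler_orb_mean_le:
  assumes normal: "\<And>\<sigma>. \<sigma> \<in> Gal \<Longrightarrow> \<sigma> ` K \<subseteq> K"
    and z: "algebraic z" and b: "orb_mean K z b"
  shows "mahler b \<le> mahler z"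
proof -
  define f where "f = (map_poly of_int (min_int_poly z) :: complex poly)"
  define A where "A = lead_coeff f"
  have A_pos: "cmod A > 0"
    using min_int_poly(2)[OF z] by (auto simp: A_def f_def)
  then have f_nz: "f \<noteq> 0" by (auto simp: A_def)
  have f_root: "poly f z = 0" using min_int_poly(3)[OF z] by (simp add: f_def)
  have f_Rats: "coeff f i \<in> \<rat>" and f_int: "algebraic_int (coeff f i)" for i
    by (simp_all add: f_def)
  \<comment> \<open>The conjugates of \<open>z\<close> over the rationals, partitioned below into
    the blocks \<open>B\<close> of conjugates over \<open>K\<close>.\<close>
  define R where "R = orb {} z"
  have R_sub: "R \<subseteq> {w. poly f w = 0}"
    unfolding R_def by (rule orb_subset_roots[OF f_Rats f_root])
  have R_fin: "finite R" unfolding R_def by (rule orb_finite[OF z])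
  have R_alg: "algebraic w" if "w \<in> R" for w
    using orb_algebraic[OF z] that by (simp add: R_def)
  have R_Gal: "\<sigma> w \<in> R" if "\<sigma> \<in> Gal" "w \<in> R" for \<sigma> w
    using Gal_over_image_orb[of \<sigma> "{}" z] that by (auto simp: R_def Gal_over_empty)
  have orb_R: "orb K w \<subseteq> R" if "w \<in> R" for w
    using R_Gal that Gal_overD(1) by (auto simp: orb_def)
  define B where "B = orb K ` R"
  define d where "d = card (orb K z)"
  have d: "d > 0" unfolding d_def by (rule card_orb_pos[OF z])
  have B_fin: "finite B" using R_fin by (simp add: B_def)
  have B_R: "X \<subseteq> R" if "X \<in> B" for X using that orb_R by (auto simp: B_def)
  have B_finX: "finite X" if "X \<in> B" for X using B_R[OF that] R_fin by (rule finite_subset)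
  have B_alg: "algebraic (\<Prod>X)" if "X \<in> B" for X
    using B_R[OF that] R_alg by (intro algebraic_prod) auto
  have B_disj: "X \<inter> Y = {}" if "X \<in> B" "Y \<in> B" "X \<noteq> Y" for X Y
  proof (rule ccontr)
    assume "X \<inter> Y \<noteq> {}"
    then obtain w where "w \<in> X" "w \<in> Y" by blast
    then have "orb K w = X" "orb K w = Y" using that orb_eq by (auto simp: B_def)
    with that show False by simp
  qed
  have B_Un: "\<Union>B = R" using orb_self B_R by (auto simp: B_def)
  have prod_B: "(\<Prod>X\<in>Y. \<Prod>x\<in>X. g x) = (\<Prod>x\<in>\<Union>Y. g x)" if "Y \<subseteq> B" for Y and g :: "complex \<Rightarrow> 'a :: comm_monoid_mult"
  proof (rule prod.Union_disjoint[symmetric, unfolded comp_def])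
    show "\<forall>A\<in>Y. finite A" "\<forall>A\<in>Y. \<forall>B\<in>Y. A \<noteq> B \<longrightarrow> A \<inter> B = {}"
      using B_finX B_disj that by blast+
  qed
  \<comment> \<open>The block of \<open>z\<close> contributes x^d - b^d, so \<open>P\<close>
    vanishes at \<open>b\<close>.\<close>
  define P where "P = Polynomial.smult A (\<Prod>X\<in>B. monom 1 d - [:\<Prod>X:])"
  have int: "algebraic_int (coeff P i)" for i
  proof -
    \<comment> \<open>Expanding over subsets of \<open>B\<close> writes each coefficient as a sum of
      terms that are 0 or, up to sign, \<open>A\<close> times a product of whole blocks. As blocks
      are disjoint, such a product runs over distinct roots of \<open>f\<close>.\<close>
    have "(\<Prod>X\<in>B. monom 1 d - [:\<Prod>X:]) = (\<Prod>X\<in>B. monom 1 d + [:- \<Prod>X:])"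
      by (rule prod.cong) (auto simp: poly_eq_iff coeff_pCons split: nat.splits)
    also have "\<dots> = (\<Sum>Y\<in>Pow B. (\<Prod>X\<in>Y. monom 1 d) * (\<Prod>X\<in>B - Y. [:- \<Prod>X:]))"
      by (rule prod_add[OF B_fin])
    finally have "coeff P i =
        (\<Sum>Y\<in>Pow B. A * coeff ((\<Prod>X\<in>Y. monom 1 d) * (\<Prod>X\<in>B - Y. [:- \<Prod>X:])) i)"
      by (simp add: P_def coeff_sum sum_distrib_left)
    also have "algebraic_int \<dots>"
    proof (rule algebraic_int_sum)
      fix Y assume "Y \<in> Pow B"
      let ?Z = "B - Y"
      have "algebraic_int (A * \<Prod>(\<Union>?Z))"
        unfolding A_def using f_nz f_int R_sub B_R
        by (intro algebraic_int_lead_coeff_mult_prod_roots) blast+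
      then have Z: "algebraic_int (A * (\<Prod>X\<in>?Z. \<Prod>X))"
        by (simp add: prod_B[of ?Z "\<lambda>x. x"])
      have "(\<Prod>X\<in>?Z. - \<Prod>X) = (\<Prod>X\<in>?Z. \<Prod>X) \<or> (\<Prod>X\<in>?Z. - \<Prod>X) = - (\<Prod>X\<in>?Z. \<Prod>X)"
        using prod_uminus[of "\<lambda>X. \<Prod>X" ?Z] by (cases "even (card ?Z)") auto
      then have Z': "algebraic_int (A * (\<Prod>X\<in>?Z. - \<Prod>X))" using Z by auto
      have "(\<Prod>X\<in>?Z. [:- \<Prod>X:]) = [:\<Prod>X\<in>?Z. - \<Prod>X:]"
        by (rule prod_const_poly)
      moreover have "(\<Prod>X\<in>Y. monom 1 d) = (monom 1 (d * card Y) :: complex poly)"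
        by (simp add: monom_power)
      ultimately show "algebraic_int (A * coeff ((\<Prod>X\<in>Y. monom 1 d) * (\<Prod>X\<in>B - Y. [:- \<Prod>X:])) i)"
        using Z' by (simp add: coeff_monom_mult coeff_pCons split: nat.splits)
    qed
    finally show ?thesis .
  qed
  \<comment> \<open>An automorphism permutes the blocks, so it only reorders the factors of
    \<open>P\<close>, while \<open>A\<close> is rational.\<close>
  have fixed: "\<sigma> (coeff P i) = coeff P i" if \<sigma>: "\<sigma> \<in> Gal" for \<sigma> i
  proof -
    let ?r = "{(x, \<sigma> x) |x. algebraic x}"
    note r = Gal_embedding[OF \<sigma>]
    have inj: "inj_on ((`) \<sigma>) B"
      using Gal_inj[OF \<sigma>] by (intro inj_onI) (simp add: inj_image_eq_iff)
    have img: "(`) \<sigma> ` B = B"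
    proof (rule endo_inj_surj[OF B_fin _ inj], rule image_subsetI)
      fix X assume "X \<in> B"
      then show "\<sigma> ` X \<in> B"
        using Gal_image_orb[OF normal \<sigma>] R_Gal[OF \<sigma>] by (auto simp: B_def)
    qed
    have "poly_rel ?r (\<Prod>X\<in>B. monom 1 d - [:\<Prod>X:]) (\<Prod>X\<in>B. monom 1 d - [:\<Prod>(\<sigma> ` X):])"
    proof (rule poly_rel_prod[OF r])
      fix X assume X: "X \<in> B"
      have "\<Prod>(\<sigma> ` X) = (\<Prod>x\<in>X. \<sigma> x)"
        using Gal_inj[OF \<sigma>] by (simp add: prod.reindex inj_on_subset)
      also have "\<dots> = \<sigma> (\<Prod>X)"
        using B_R[OF X] R_alg by (intro Gal_prod[OF \<sigma>, symmetric]) auto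
      finally have "(\<Prod>X, \<Prod>(\<sigma> ` X)) \<in> ?r" using B_alg[OF X] by auto
      then have "poly_rel ?r (monom (\<Prod>X) 0) (monom (\<Prod>(\<sigma> ` X)) 0)"
        by (rule poly_rel_monom[OF r])
      moreover have "poly_rel ?r (monom 1 d) (monom 1 d)"
        by (intro poly_rel_monom[OF r] embedding_Rats[OF r]) simp
      ultimately show "poly_rel ?r (monom 1 d - [:\<Prod>X:]) (monom 1 d - [:\<Prod>(\<sigma> ` X):])"
        unfolding monom_0 by (intro poly_rel_diff[OF r])
    qed
    also have "(\<Prod>X\<in>B. monom 1 d - [:\<Prod>(\<sigma> ` X):]) = (\<Prod>X\<in>(`) \<sigma> ` B. monom 1 d - [:\<Prod>X:])"
      by (simp add: prod.reindex[OF inj])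
    also have "\<dots> = (\<Prod>X\<in>B. monom 1 d - [:\<Prod>X:])" by (simp only: img)
    finally have "poly_rel ?r (\<Prod>X\<in>B. monom 1 d - [:\<Prod>X:]) (\<Prod>X\<in>B. monom 1 d - [:\<Prod>X:])" .
    moreover have "poly_rel ?r (monom A 0) (monom A 0)"
      using f_Rats by (intro poly_rel_monom[OF r] embedding_Rats[OF r]) (simp add: A_def)
    ultimately have "poly_rel ?r (monom A 0 * (\<Prod>X\<in>B. monom 1 d - [:\<Prod>X:]))
        (monom A 0 * (\<Prod>X\<in>B. monom 1 d - [:\<Prod>X:]))"
      by (intro poly_rel_mult[OF r])
    then show ?thesis by (auto simp: poly_rel_def P_def monom_0)
  qed
  have "coeff P i \<in> \<rat>" for i
  proof (rule fixed_by_Gal_over[OF is_subfield_Rats rat_imp_algebraic algebraic_int_imp_algebraic[OF int]])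
    fix \<sigma> :: "complex \<Rightarrow> complex" assume "\<sigma> \<in> Gal_over \<rat>"
    then show "\<sigma> (coeff P i) = coeff P i" by (rule fixed[OF Gal_overD(1)])
  qed
  then have "coeff P i \<in> \<int>" for i
    using int rational_algebraic_int_is_int by blast
  then obtain p where p: "P = map_poly of_int p" by (rule intpolyE)
  have nz: "monom 1 d - [:c:] \<noteq> 0" for c :: complex
  proof
    assume "monom 1 d - [:c:] = 0"
    then have "coeff (monom 1 d - [:c:]) d = 0" by simp
    then show False using d by (simp add: coeff_pCons split: nat.splits)
  qed
  then have P_nz: "P \<noteq> 0"
    using A_pos B_fin by (auto simp: P_def prod_zero_iff)
  have "poly P b = A * (\<Prod>X\<in>B. b ^ d - \<Prod>X)"
    by (simp add: P_def poly_prod poly_monom)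
  moreover have "orb K z \<in> B" "b ^ d = \<Prod>(orb K z)"
    using b orb_self[of z "{}"] by (auto simp: B_def R_def d_def orb_mean_def)
  ultimately have "poly P b = 0"
    using B_fin by (auto simp: prod_zero_iff)
  then have "mahler b \<le> Mahler_poly P"
    using mahler_le_Mahler_poly[of p b] P_nz by (auto simp: p)
  also have "\<dots> = cmod A * (\<Prod>X\<in>B. max 1 (cmod (\<Prod>X)))"
    using A_pos B_fin nz by (simp add: P_def Mahler_poly_smult Mahler_poly_prod Mahler_poly_binomial[OF d])
  \<comment> \<open>Merging a block can only lower the measure: conjugates inside the unit disc
    reduce the modulus of the product, but count as 1 on the right.\<close>
  also have "\<dots> \<le> cmod A * (\<Prod>X\<in>B. \<Prod>x\<in>X. max 1 (cmod x))"
  proof (intro mult_left_mono prod_mono conjI)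
    fix X assume "X \<in> B"
    have "cmod (\<Prod>X) \<le> (\<Prod>x\<in>X. max 1 (cmod x))"
      unfolding prod_norm[symmetric] by (intro prod_mono) auto
    moreover have "1 \<le> (\<Prod>x\<in>X. max 1 (cmod x))" by (intro prod_ge_1) auto
    ultimately show "max 1 (cmod (\<Prod>X)) \<le> (\<Prod>x\<in>X. max 1 (cmod x))" by simp
  qed auto
  also have "\<dots> = cmod A * (\<Prod>x\<in>R. max 1 (cmod x))"
    by (simp add: prod_B B_Un)
  also have "\<dots> \<le> cmod A * (\<Prod>x\<in>{w. poly f w = 0}. max 1 (cmod x) ^ Polynomial.order x f)"
  proof (rule mult_left_mono)
    \<comment> \<open>Passing from the orbit to all roots, and then to multiplicities, inserts only
      factors that are at least 1.\<close>
    have "(\<Prod>x\<in>R. max 1 (cmod x)) \<le> (\<Prod>x\<in>{w. poly f w = 0}. max 1 (cmod x))"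
      using R_sub by (intro prod_mono2 poly_roots_finite f_nz) auto
    also have "\<dots> \<le> (\<Prod>x\<in>{w. poly f w = 0}. max 1 (cmod x) ^ Polynomial.order x f)"
    proof (intro prod_mono conjI)
      fix x assume "x \<in> {w. poly f w = 0}"
      then have "1 \<le> Polynomial.order x f" using f_nz by (simp add: order_root Suc_le_eq)
      then show "max 1 (cmod x) \<le> max 1 (cmod x) ^ Polynomial.order x f"
        using power_increasing[of 1 _ "max 1 (cmod x)"] by simp
    qed auto
    finally show "(\<Prod>x\<in>R. max 1 (cmod x)) \<le> \<dots>" .
  qed simp
  also have "\<dots> = mahler z"
    using f_nz by (simp add: mahler_eq_Mahler_poly[OF z] Mahler_poly_altdef A_def flip: f_def)
  finally show ?thesis .
qed

section \<open>The Galois closure as a Galois-stable field of algebraic numbers\<close>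

lemma is_subfield_gen_field: "is_subfield (gen_field S)"
  unfolding is_subfield_def
proof (intro conjI ballI)
  show "0 \<in> gen_field S" "1 \<in> gen_field S"
    by (simp_all add: gen_field_def is_subfield_def)
next
  fix x y assume "x \<in> gen_field S" "y \<in> gen_field S"
  then have "\<And>F. is_subfield F \<Longrightarrow> S \<subseteq> F \<Longrightarrow> x \<in> F \<and> y \<in> F"
    by (simp add: gen_field_def)
  then show "x + y \<in> gen_field S" "x - y \<in> gen_field S" "x * y \<in> gen_field S"
    by (simp_all add: gen_field_def is_subfield_def)
next
  fix x assume "x \<in> gen_field S"
  then show "inverse x \<in> gen_field S"
    by (simp add: gen_field_def is_subfield_def)
qed

lemma gen_field_superset: "S \<subseteq> gen_field S"
  by (auto simp: gen_field_def)

lemma gen_field_least: "is_subfield F \<Longrightarrow> S \<subseteq> F \<Longrightarrow> gen_field S \<subseteq> F"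
  by (auto simp: gen_field_def)

lemma galois_closure_algebraic:
  assumes \<alpha>: "algebraic \<alpha>" and "x \<in> galois_closure \<alpha>"
  shows "algebraic x"
proof -
  have "is_subfield {x. algebraic x}"
    by (auto simp: is_subfield_def intro: algebraic_add algebraic_diff algebraic_mult)
  moreover have "min_int_poly \<alpha> \<noteq> 0" using min_int_poly(2)[OF \<alpha>] by auto
  then have "{z. poly (map_poly of_int (min_int_poly \<alpha>)) z = 0} \<subseteq> {x. algebraic x}"
    by (auto intro!: algebraicI[of "map_poly of_int (min_int_poly \<alpha>)"])
  ultimately show ?thesis
    using assms(2) gen_field_least unfolding galois_closure_def by blast
qed

lemma galois_closure_self: "algebraic \<alpha> \<Longrightarrow> \<alpha> \<in> galois_closure \<alpha>"
  unfolding galois_closure_def by (rule subsetD[OF gen_field_superset]) (simp add: min_int_poly(3))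

text \<open>The elements of the closure whose images stay in it form a subfield. It contains the
  generating roots because \<open>\<sigma>\<close> preserves the roots of a rational polynomial, so
  it is the whole closure.\<close>

lemma Gal_galois_closure:
  assumes \<alpha>: "algebraic \<alpha>" and \<sigma>: "\<sigma> \<in> Gal" and x: "x \<in> galois_closure \<alpha>"
  shows "\<sigma> x \<in> galois_closure \<alpha>"
proof -
  define K where "K = galois_closure \<alpha>"
  let ?S = "{z. poly (map_poly of_int (min_int_poly \<alpha>)) z = 0}"
  have K: "is_subfield K" by (simp add: K_def galois_closure_def is_subfield_gen_field)
  have alg: "algebraic y" if "y \<in> K" for y
    using that galois_closure_algebraic[OF \<alpha>] by (simp add: K_def)
  let ?F = "{y \<in> K. \<sigma> y \<in> K}"
  have "is_subfield ?F"
    using K alg Gal_Rats[OF \<sigma>]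
    by (auto simp: is_subfield_def Gal_add[OF \<sigma>] Gal_diff[OF \<sigma>] Gal_mult[OF \<sigma>] Gal_inverse[OF \<sigma>])
  moreover have "?S \<subseteq> ?F"
    using Gal_root[OF \<sigma>, of "map_poly of_int (min_int_poly \<alpha>)"] gen_field_superset[of ?S]
    unfolding K_def galois_closure_def by auto
  ultimately have "gen_field ?S \<subseteq> ?F" by (rule gen_field_least)
  with x show ?thesis unfolding K_def galois_closure_def by blast
qed

section \<open>Replacing the factors by their normalised norms over the Galois closure\<close>

theorem mainTheorem7:
  fixes \<alpha> :: complex and N :: nat and a :: "nat \<Rightarrow> complex"
  assumes "alg_nz \<alpha>"
    and "\<forall>n\<in>{1..N}. alg_nz (a n)"
    and "same_class \<alpha> (\<Prod>n=1..N. a n)"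
  shows "\<exists>b :: nat \<Rightarrow> complex. (\<forall>n\<in>{1..N}. alg_nz (b n)) \<and>
           same_class \<alpha> (\<Prod>n=1..N. b n) \<and>
           (\<forall>n\<in>{1..N}. in_S (galois_closure \<alpha>) (b n) \<and> mahler_bar (b n) \<le> mahler_bar (a n))"
proof -
  define K where "K = galois_closure \<alpha>"
  have \<alpha>: "algebraic \<alpha>" using assms(1) by (simp add: alg_nz_def)
  have K: "is_subfield K" by (simp add: K_def galois_closure_def is_subfield_gen_field)
  have K_alg: "algebraic x" if "x \<in> K" for x
    using that galois_closure_algebraic[OF \<alpha>] by (simp add: K_def)
  have normal: "\<sigma> ` K \<subseteq> K" if "\<sigma> \<in> Gal" for \<sigma>
    using Gal_galois_closure[OF \<alpha> that] by (auto simp: K_def)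
  have "\<forall>n\<in>{1..N}. \<exists>b. orb_mean K (a n) b"
    using assms(2) orb_mean_exists[of _ K] by (metis alg_nz_def)
  then obtain b where b: "\<And>n. n \<in> {1..N} \<Longrightarrow> orb_mean K (a n) (b n)" by metis
  have b_nz: "alg_nz (b n)" if "n \<in> {1..N}" for n
    using orb_mean_alg_nz b assms(2) that by blast
  \<comment> \<open>As \<open>\<alpha>\<close> lies in \<open>K\<close>, its orbit is a singleton
    and it is its own normalised norm.\<close>
  have "orb_mean K \<alpha> \<alpha>"
    using galois_closure_self[OF \<alpha>] by (simp add: orb_mean_def K_def orb_fixed)
  then have same: "same_class \<alpha> (\<Prod>n=1..N. b n)"
    using assms b by (intro same_class_orb_mean[of _ a K b \<alpha>]) auto
  have S: "in_S K (b n)" if n: "n \<in> {1..N}" for n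
  proof -
    have an: "algebraic (a n)" using assms(2) n by (auto simp: alg_nz_def)
    have "b n ^ card (orb K (a n)) \<in> K"
      using b[OF n] prod_orb_in_subfield[OF K K_alg an] by (simp add: orb_mean_def)
    then have "b n \<in> rad K"
      using b_nz[OF n] card_orb_pos[OF an] by (auto simp: rad_def)
    moreover have "same_class (b n) (b n)"
      using b_nz[OF n] by (auto simp: same_class_def root_of_unity_def alg_nz_def)
    ultimately show ?thesis by (auto simp: in_S_def)
  qed
  \<comment> \<open>Every representative \<open>\<beta>\<close> of the class of \<open>a n\<close>
    has a normalised norm \<open>c\<close> of no larger measure. It lies in the class of
    \<open>b n\<close>, so it competes in the infimum there.\<close>
  have M: "mahler_bar (b n) \<le> mahler_bar (a n)" if n: "n \<in> {1..N}" for n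
    unfolding mahler_bar_def[of "a n"]
  proof (rule cInf_greatest)
    have "same_class (a n) (a n)"
      using assms(2) n by (auto simp: same_class_def root_of_unity_def alg_nz_def)
    then show "{mahler \<beta> |\<beta>. alg_nz \<beta> \<and> same_class \<beta> (a n)} \<noteq> {}"
      using assms(2) n by blast
  next
    fix m assume "m \<in> {mahler \<beta> |\<beta>. alg_nz \<beta> \<and> same_class \<beta> (a n)}"
    then obtain \<beta> where \<beta>: "m = mahler \<beta>" "alg_nz \<beta>" "same_class \<beta> (a n)" by blast
    then have \<beta>_alg: "algebraic \<beta>" by (simp add: alg_nz_def)
    obtain c where c: "orb_mean K \<beta> c" using orb_mean_exists[OF \<beta>_alg] .
    have "same_class c (\<Prod>i\<in>{n}. b i)"
      using assms(2) n b \<beta> c by (intro same_class_orb_mean[of _ a K b \<beta>]) auto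
    then have "mahler c \<in> {mahler \<beta> |\<beta>. alg_nz \<beta> \<and> same_class \<beta> (b n)}"
      using orb_mean_alg_nz[OF \<beta>(2) c] by auto
    \<comment> \<open>The real infimum bounds its members only for a set bounded below; here 1 is a
      bound.\<close>
    moreover have "bdd_below {mahler \<beta> |\<beta>. alg_nz \<beta> \<and> same_class \<beta> (b n)}"
      by (rule bdd_belowI[of _ 1]) (auto simp: alg_nz_def intro: mahler_ge_1)
    ultimately have "mahler_bar (b n) \<le> mahler c"
      unfolding mahler_bar_def by (rule cInf_lower)
    also have "\<dots> \<le> m" using mahler_orb_mean_le[OF normal \<beta>_alg c] \<beta>(1) by simp
    finally show "mahler_bar (b n) \<le> m" .
  qed
  show ?thesis
    using b_nz same S M by (intro exI[of _ b]) (auto simp: K_def)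
qed

end
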